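(* Let $\varphi$ be a univalent holomorphic self-map of $\mathbb{D}$ with $\varphi''\in H^{\infty}(\mathbb{D})$, and let $\psi \in \mathrm{Hol}(\mathbb{D})$. (i) If $\sup_{z \in \mathbb{D}}|\psi''(z)|(1-|z|^2)<\infty$ and $C_{\psi,\varphi}$ is bounded on $\mathcal{D}_{\alpha}$ for some $\alpha \in (0,1)$, then $C_{\psi,\varphi}$ is bounded on $\mathcal{D}_{\beta}$ for every $\beta \in (\alpha,1)$. (ii) If $\lim_{|z|\to 1^-}|\psi''(z)|(1-|z|^2)=0$ and $C_{\psi,\varphi}$ is compact on $\mathcal{D}_{\alpha}$ for some $\alpha \in (0,1)$, then $C_{\psi,\varphi}$ is compact on $\mathcal{D}_{\beta}$ for every $\beta \in (\alpha,1)$.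
   Context: $\mathbb{D}=\{z\in\mathbb{C}:|z|<1\}$; $\mathrm{Hol}(\mathbb{D})$ is the space of complex-valued holomorphic functions on $\mathbb{D}$ and $H^\infty(\mathbb{D})$ the space of bounded ones. A holomorphic self-map of $\mathbb{D}$ is $\varphi\in\mathrm{Hol}(\mathbb{D})$ with $\varphi(\mathbb{D})\subseteq\mathbb{D}$; univalent means injective. For $\psi\in\mathrm{Hol}(\mathbb{D})$ and a holomorphic self-map $\varphi$, the weighted composition operator is $C_{\psi,\varphi}f=\psi\,(f\circ\varphi)$ for $f\in\mathrm{Hol}(\mathbb{D})$. For $\alpha\in\mathbb{R}$, the weighted Dirichlet space $\mathcal{D}_\alpha$ is the Hilbert space of all $f(z)=\sum_{n\ge 0}a_nz^n\in\mathrm{Hol}(\mathbb{D})$ with $\|f\|_{\mathcal{D}_\alpha}^2=\sum_{n\ge 0}(n+1)^{1-\alpha}|a_n|^2<\infty$, with inner product $\langle f,g\rangle_{\mathcal{D}_\alpha}=\sum_{n\ge 0}(n+1)^{1-\alpha}a_n\overline{b_n}$ for $g(z)=\sum_{n\ge0} b_nz^n$. "$C_{\psi,\varphi}$ is bounded (compact) on $\mathcal{D}_\alpha$" means that it maps $\mathcal{D}_\alpha$ into itself and is a bounded (compact) linear operator there. *)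

theory Defs
  imports "HOL-Complex_Analysis.Complex_Analysis"
begin

abbreviation unit_disc :: "complex set" ("\<bbbD>")
  where "\<bbbD> \<equiv> ball 0 1"

definition H_inf :: "(complex \<Rightarrow> complex) set"
  where "H_inf = {f. f holomorphic_on \<bbbD> \<and> bounded (f ` \<bbbD>)}"

definition self_map :: "(complex \<Rightarrow> complex) \<Rightarrow> bool"
  where "self_map \<phi> \<longleftrightarrow> \<phi> holomorphic_on \<bbbD> \<and> \<phi> ` \<bbbD> \<subseteq> \<bbbD>"

definition weighted_comp ::
    "(complex \<Rightarrow> complex) \<Rightarrow> (complex \<Rightarrow> complex) \<Rightarrow> (complex \<Rightarrow> complex) \<Rightarrow> complex \<Rightarrow> complex"
  where "weighted_comp \<psi> \<phi> f = (\<lambda>z. \<psi> z * f (\<phi> z))"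

text \<open>
  Elements of the function spaces are total functions of which only the values on the unit disc
  matter: membership, the norm and convergence below depend on nothing else, so that functions
  agreeing on the disc represent the same element. For a function holomorphic on the disc,
  \<open>fps_expansion f 0\<close> is its Taylor series at the origin.
\<close>

definition dirichlet_term :: "real \<Rightarrow> (complex \<Rightarrow> complex) \<Rightarrow> nat \<Rightarrow> real"
  where "dirichlet_term \<alpha> f n =
    (real n + 1) powr (1 - \<alpha>) * (cmod (fps_nth (fps_expansion f 0) n))\<^sup>2"

definition dirichlet_space :: "real \<Rightarrow> (complex \<Rightarrow> complex) set"
  where "dirichlet_space \<alpha> = {f. f holomorphic_on \<bbbD> \<and> summable (dirichlet_term \<alpha> f)}"

definition dirichlet_norm :: "real \<Rightarrow> (complex \<Rightarrow> complex) \<Rightarrow> real"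
  where "dirichlet_norm \<alpha> f = sqrt (\<Sum>n. dirichlet_term \<alpha> f n)"

definition linear_operator_on ::
    "real \<Rightarrow> ((complex \<Rightarrow> complex) \<Rightarrow> complex \<Rightarrow> complex) \<Rightarrow> bool"
  where "linear_operator_on \<alpha> T \<longleftrightarrow>
    (\<forall>f\<in>dirichlet_space \<alpha>. T f \<in> dirichlet_space \<alpha>) \<and>
    (\<forall>f\<in>dirichlet_space \<alpha>. \<forall>g\<in>dirichlet_space \<alpha>. \<forall>z\<in>\<bbbD>.
        T (\<lambda>w. f w + g w) z = T f z + T g z) \<and>
    (\<forall>c. \<forall>f\<in>dirichlet_space \<alpha>. \<forall>z\<in>\<bbbD>. T (\<lambda>w. c * f w) z = c * T f z)"

definition bounded_operator_on ::
    "real \<Rightarrow> ((complex \<Rightarrow> complex) \<Rightarrow> complex \<Rightarrow> complex) \<Rightarrow> bool"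
  where "bounded_operator_on \<alpha> T \<longleftrightarrow>
    linear_operator_on \<alpha> T \<and>
    (\<exists>K. \<forall>f\<in>dirichlet_space \<alpha>. dirichlet_norm \<alpha> (T f) \<le> K * dirichlet_norm \<alpha> f)"

text \<open>
  Compactness: every norm-bounded sequence has a subsequence whose image converges in norm
  to an element of the space.
\<close>

definition compact_operator_on ::
    "real \<Rightarrow> ((complex \<Rightarrow> complex) \<Rightarrow> complex \<Rightarrow> complex) \<Rightarrow> bool"
  where "compact_operator_on \<alpha> T \<longleftrightarrow>
    linear_operator_on \<alpha> T \<and>
    (\<forall>F :: nat \<Rightarrow> complex \<Rightarrow> complex.
        (\<forall>k. F k \<in> dirichlet_space \<alpha>) \<and> (\<exists>M. \<forall>k. dirichlet_norm \<alpha> (F k) \<le> M) \<longrightarrow>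
        (\<exists>g\<in>dirichlet_space \<alpha>. \<exists>r :: nat \<Rightarrow> nat. strict_mono r \<and>
           (\<lambda>k. dirichlet_norm \<alpha> (\<lambda>z. T (F (r k)) z - g z)) \<longlonglongrightarrow> 0))"

end

theory Submission
  imports Defs
begin

text \<open>
  The argument is interpolation. In the notation of the definitions, the space for the parameter
  \<open>1\<close> is the Hardy space: its squared norm is the unweighted sum of the squared Taylor
  coefficients. For \<open>\<alpha> < \<beta> < 1\<close> the weight \<open>(n + 1) powr (1 - \<beta>)\<close> is the power with exponent
  \<open>s = (1 - \<beta>) / (1 - \<alpha>)\<close>, which lies strictly between \<open>0\<close> and \<open>1\<close>, of the weight
  \<open>(n + 1) powr (1 - \<alpha>)\<close>. So the space for \<open>\<beta>\<close> lies between the one for \<open>\<alpha>\<close> and the Hardy space,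
  and it suffices to see that the operator is bounded on the Hardy space.

  There the growth condition on the second derivative of the weight \<open>\<psi>\<close> makes \<open>\<psi>\<close> bounded, by
  Taylor's formula with integral remainder along radii
  (\<open>bounded_if_second_derivative_growth\<close>). Composition with \<open>\<phi>\<close> is bounded on the
  Hardy space by Littlewood's subordination principle (\<open>littlewood_subordination\<close>), proved
  here for polynomials by peeling off one coefficient at a time.

  The interpolation (\<open>energy_interpolation\<close>) is the real method with dyadic parameters. With
  \<open>w\<close> the weight for \<open>\<alpha>\<close>, the number \<open>w powr s\<close> is comparable to the sum over \<open>j\<close> of
  \<open>2 powr (j * s) * min 1 (w / 2 ^ j)\<close>, and at each scale \<open>2 ^ j\<close> the function is cut into a
  polynomial, handled in the space for \<open>\<alpha>\<close>, and a remainder, handled in the Hardy space.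

  For an operator bounded on the Hardy space, compactness on the space for \<open>\<alpha>\<close> amounts to an inequality
  \<open>\<parallel>T f\<parallel>\<^sup>2 \<le> \<delta> \<parallel>f\<parallel>\<^sup>2 + L \<parallel>f\<parallel>\<^sup>2\<close>, where the last norm is the Hardy norm and \<open>\<delta>\<close>
  is as small as desired, at the price of a large \<open>L\<close>. That inequality survives
  interpolation, because \<open>\<delta>\<close> enters the interpolated bound as \<open>\<delta> powr s\<close>, and on the space for \<open>\<beta>\<close>
  it gives compactness back, because the inclusion of that space in the Hardy space is compact.
\<close>

section \<open>Taylor coefficients on the unit disc\<close>

abbreviation taylor_coeff :: "(complex \<Rightarrow> complex) \<Rightarrow> nat \<Rightarrow> complex"
  where "taylor_coeff f n \<equiv> fps_nth (fps_expansion f 0) n"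

lemma has_fps_expansion_disc:
  "f holomorphic_on \<bbbD> \<Longrightarrow> f has_fps_expansion fps_expansion f 0"
  by (rule has_fps_expansion_fps_expansion[of \<bbbD>]) auto

lemma taylor_coeff_add:
  assumes "f holomorphic_on \<bbbD>" "g holomorphic_on \<bbbD>"
  shows "taylor_coeff (\<lambda>z. f z + g z) n = taylor_coeff f n + taylor_coeff g n"
  using fps_expansion_eqI[OF has_fps_expansion_add[OF assms[THEN has_fps_expansion_disc]]] by simp

lemma taylor_coeff_diff:
  assumes "f holomorphic_on \<bbbD>" "g holomorphic_on \<bbbD>"
  shows "taylor_coeff (\<lambda>z. f z - g z) n = taylor_coeff f n - taylor_coeff g n"
  using fps_expansion_eqI[OF has_fps_expansion_diff[OF assms[THEN has_fps_expansion_disc]]] by simp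

lemma taylor_coeff_cmult:
  assumes "f holomorphic_on \<bbbD>"
  shows "taylor_coeff (\<lambda>z. c * f z) n = c * taylor_coeff f n"
  using fps_expansion_eqI[OF has_fps_expansion_cmult_left[OF has_fps_expansion_disc[OF assms]], of c]
  by simp

lemma taylor_sums:
  assumes "f holomorphic_on \<bbbD>" "z \<in> \<bbbD>"
  shows "(\<lambda>n. taylor_coeff f n * z ^ n) sums f z"
  using holomorphic_power_series[OF assms] by (simp add: fps_expansion_def)

lemma taylor_coeff_cong:
  assumes "\<And>z. z \<in> \<bbbD> \<Longrightarrow> f z = g z"
  shows "taylor_coeff f n = taylor_coeff g n"
proof -
  have "eventually (\<lambda>z. z \<in> \<bbbD>) (nhds (0::complex))"
    by (rule eventually_nhds_in_open) auto
  then have "\<forall>\<^sub>F z in nhds 0. f z = g z"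
    by eventually_elim (use assms in auto)
  then show ?thesis by (simp add: fps_expansion_cong)
qed

lemma taylor_coeff_power_series:
  assumes "\<And>z. z \<in> \<bbbD> \<Longrightarrow> (\<lambda>n. a n * z ^ n) sums f z"
  shows "taylor_coeff f n = a n" and "f holomorphic_on \<bbbD>"
proof -
  have "eventually (\<lambda>z. z \<in> \<bbbD>) (nhds (0::complex))"
    by (rule eventually_nhds_in_open) auto
  then have "eventually (\<lambda>u. (\<lambda>n. fps_nth (Abs_fps a) n * u ^ n) sums f u) (nhds 0)"
    by eventually_elim (use assms in auto)
  then show "taylor_coeff f n = a n"
    using fps_expansion_eqI[OF has_fps_expansionI] by fastforce
  show "f holomorphic_on \<bbbD>"
    using power_series_holomorphic[of 0 1 a f] assms by simp
qed

lemma taylor_coeff_finite_sum: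
  assumes "finite A"
  shows "taylor_coeff (\<lambda>z. \<Sum>n\<in>A. a n * z ^ n) m = (if m \<in> A then a m else 0)"
proof (rule taylor_coeff_power_series(1))
  fix z :: complex
  have "(\<lambda>n. (if n \<in> A then a n else 0) * z ^ n) = (\<lambda>n. if n \<in> A then a n * z ^ n else 0)"
    by auto
  then show "(\<lambda>n. (if n \<in> A then a n else 0) * z ^ n) sums (\<Sum>n\<in>A. a n * z ^ n)"
    using sums_If_finite_set[OF assms, of "\<lambda>n. a n * z ^ n"] by simp
qed

lemma holomorphic_on_poly [holomorphic_intros]: "poly p holomorphic_on A" for p :: "complex poly"
  by (induction p) (auto intro!: holomorphic_intros)

section \<open>Means over circles\<close>

text \<open>
  The parametrisation by the unit interval makes this the normalised mean, and it is the one for which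
  contour integrals unfold to it.
\<close>

definition circle_mean :: "real \<Rightarrow> (complex \<Rightarrow> 'a::euclidean_space) \<Rightarrow> 'a"
  where "circle_mean r u = integral {0..1} (\<lambda>t. u (circlepath 0 r t))"

lemma circlepath_in_sphere: "0 \<le> r \<Longrightarrow> cmod (circlepath 0 r t) = r"
  by (simp add: circlepath norm_mult)

lemma circle_integrable:
  fixes u :: "complex \<Rightarrow> 'a::euclidean_space"
  assumes "continuous_on (sphere 0 r) u" "0 \<le> r"
  shows "(\<lambda>t. u (circlepath 0 r t)) integrable_on {0..1}"
proof (rule integrable_continuous_real, rule continuous_on_compose2[OF assms(1)])
  show "continuous_on {0..1} (circlepath 0 r)"
    by (simp add: path_def[symmetric])
qed (use assms(2) in \<open>auto simp: circlepath_in_sphere\<close>)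

lemma circle_mean_add:
  fixes u v :: "complex \<Rightarrow> 'a::euclidean_space"
  assumes "continuous_on (sphere 0 r) u" "continuous_on (sphere 0 r) v" "0 \<le> r"
  shows "circle_mean r (\<lambda>z. u z + v z) = circle_mean r u + circle_mean r v"
  unfolding circle_mean_def using assms by (intro integral_add circle_integrable)

lemma circle_mean_const [simp]: "circle_mean r (\<lambda>z. c) = c"
  by (simp add: circle_mean_def)

lemma circle_mean_cmult: "circle_mean r (\<lambda>z. c * u z) = c * circle_mean r u" 
  for u :: "complex \<Rightarrow> 'a::{euclidean_space,real_normed_field}"
  by (simp add: circle_mean_def)

lemma circle_mean_mono:
  fixes u v :: "complex \<Rightarrow> real"
  assumes "continuous_on (sphere 0 r) u" "continuous_on (sphere 0 r) v" "0 \<le> r"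
    and "\<And>z. cmod z = r \<Longrightarrow> u z \<le> v z"
  shows "circle_mean r u \<le> circle_mean r v"
  unfolding circle_mean_def using assms
  by (intro integral_le circle_integrable) (auto simp: circlepath_in_sphere)

lemma circle_mean_Re:
  fixes u :: "complex \<Rightarrow> complex"
  assumes "continuous_on (sphere 0 r) u" "0 \<le> r"
  shows "circle_mean r (\<lambda>z. Re (u z)) = Re (circle_mean r u)"
  unfolding circle_mean_def
  using integral_linear[OF circle_integrable[OF assms] bounded_linear_Re] by (simp add: o_def)

text \<open>
  This is Cauchy's formula for the Taylor coefficients: along the circle
  \<open>dz = 2 \<pi> \<i> z dt\<close>, which cancels one of the factors \<open>z\<close> in the denominator.
\<close>

lemma circle_mean_holomorphic_div_power:
  assumes "f holomorphic_on \<bbbD>" "0 < r" "r < 1"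
  shows "circle_mean r (\<lambda>z. f z / z ^ n) = taylor_coeff f n"
proof -
  let ?c = "circlepath 0 r"
  have sub: "cball 0 r \<subseteq> \<bbbD>" "ball 0 r \<subseteq> \<bbbD>" using assms by auto
  have "((\<lambda>u. f u / (u - 0) ^ Suc n) has_contour_integral
      (2 * pi * \<i>) / fact n * (deriv ^^ n) f 0) ?c"
    by (rule Cauchy_has_contour_integral_higher_derivative_circlepath)
       (use assms sub in \<open>auto intro: holomorphic_on_subset holomorphic_on_imp_continuous_on\<close>)
  then have "((\<lambda>t. f (?c t) / (?c t) ^ Suc n * (2 * pi * \<i> * ?c t)) has_integral
      (2 * pi * \<i>) * taylor_coeff f n) {0..1}"
    unfolding has_contour_integral_def
    by (rule has_integral_eq_rhs[OF has_integral_eq[rotated]])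
       (auto simp: vector_derivative_circlepath01 fps_expansion_def, simp add: circlepath)
  from has_integral_mult_right[OF this, of "1 / (2 * pi * \<i>)"]
  have "((\<lambda>t. f (?c t) / (?c t) ^ n) has_integral taylor_coeff f n) {0..1}"
    by (rule has_integral_eq_rhs[OF has_integral_eq[rotated]])
       (use assms(2) in \<open>auto simp: field_simps circlepath\<close>)
  then show ?thesis
    by (simp add: circle_mean_def integral_unique)
qed

lemma circle_mean_holomorphic:
  assumes "f holomorphic_on \<bbbD>" "0 < r" "r < 1"
  shows "circle_mean r f = f 0"
  using circle_mean_holomorphic_div_power[OF assms, of 0] by (simp add: fps_expansion_def)

lemma cmod_add_power2: "(cmod (a + b))\<^sup>2 = (cmod a)\<^sup>2 + 2 * Re (cnj a * b) + (cmod b)\<^sup>2"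
  unfolding cmod_power2 by (simp add: power2_eq_square algebra_simps)

text \<open>
  Subtracting from \<open>f\<close> its Taylor polynomial leaves a remainder \<open>R N\<close> vanishing to order \<open>N\<close>.
  On the circle the conjugate of \<open>z\<close> is \<open>r\<^sup>2 / z\<close>, so the inner product of \<open>z ^ N\<close> with \<open>R (Suc N)\<close>
  is a Taylor coefficient of \<open>R (Suc N)\<close>, and that coefficient is zero. Hence each step splits off
  one term of the sum orthogonally.
\<close>

lemma bessel_circle_mean:
  assumes "f holomorphic_on \<bbbD>" "0 < r" "r < 1"
  shows "(\<Sum>n<N. (cmod (taylor_coeff f n))\<^sup>2 * r ^ (2 * n)) \<le> circle_mean r (\<lambda>z. (cmod (f z))\<^sup>2)"
proof -
  let ?S = "\<lambda>f n. (cmod (taylor_coeff f n))\<^sup>2 * r ^ (2 * n)"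
  define R where "R N z = f z - (\<Sum>n<N. taylor_coeff f n * z ^ n)" for N z
  have hR [holomorphic_intros]: "R N holomorphic_on \<bbbD>" for N
    unfolding R_def using assms by (intro holomorphic_intros) auto
  have R_Suc: "R N z = taylor_coeff f N * z ^ N + R (Suc N) z" for N z
    by (simp add: R_def)
  have cR: "continuous_on (sphere 0 r) (R N)" for N
    by (rule continuous_on_subset[OF holomorphic_on_imp_continuous_on[OF hR]]) (use assms in auto)
  have coeff_R: "taylor_coeff (R (Suc N)) N = 0" for N
  proof -
    let ?p = "\<lambda>z. \<Sum>n<Suc N. taylor_coeff f n * z ^ n"
    have "taylor_coeff ?p N = taylor_coeff f N"
      by (subst taylor_coeff_finite_sum) auto
    moreover have "taylor_coeff (R (Suc N)) N = taylor_coeff f N - taylor_coeff ?p N"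
      unfolding R_def by (rule taylor_coeff_diff) (use assms in \<open>auto intro!: holomorphic_intros\<close>)
    ultimately show ?thesis by simp
  qed
  have step: "circle_mean r (\<lambda>z. (cmod (R N z))\<^sup>2)
      = ?S f N + circle_mean r (\<lambda>z. (cmod (R (Suc N) z))\<^sup>2)" for N
  proof -
    let ?a = "taylor_coeff f N" and ?v = "\<lambda>z. cnj (taylor_coeff f N) * r ^ (2 * N) * (R (Suc N) z / z ^ N)"
    \<comment> \<open>\<open>?v\<close> is the integrand of the inner product of split-off term and remainder, after the
      conjugate of \<open>z\<close> has been replaced by \<open>r\<^sup>2 / z\<close>.\<close>
    have cont: "continuous_on (sphere 0 r) ?v"
      by (intro continuous_intros cR) (use assms in auto)
    have "circle_mean r (\<lambda>z. (cmod (R N z))\<^sup>2)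
        = circle_mean r (\<lambda>z. ?S f N + 2 * Re (?v z) + (cmod (R (Suc N) z))\<^sup>2)"
      unfolding circle_mean_def
    proof (rule integral_cong, goal_cases)
      case (1 t)
      let ?z = "circlepath 0 r t"
      have "?z * cnj ?z = of_real (r\<^sup>2)"
        using circlepath_in_sphere[of r t] assms by (metis complex_norm_square less_imp_le of_real_power)
      moreover have "?z \<noteq> 0" using circlepath_in_sphere[of r t] assms by auto
      ultimately have "cnj ?z = of_real (r\<^sup>2) / ?z" by (simp add: field_simps)
      then have "cnj (?a * ?z ^ N) * R (Suc N) ?z = ?v ?z"
        by (simp add: power_divide power_mult)
      then show ?case
        unfolding R_Suc[of N] cmod_add_power2
        using circlepath_in_sphere[of r t] assms
        by (simp add: norm_mult norm_power power_mult_distrib power_mult[symmetric] mult.commute)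
    qed
    also have "\<dots> = ?S f N + 2 * circle_mean r (\<lambda>z. Re (?v z)) + circle_mean r (\<lambda>z. (cmod (R (Suc N) z))\<^sup>2)"
      using assms cont cR by (simp add: circle_mean_add circle_mean_cmult continuous_intros)
    also have "circle_mean r (\<lambda>z. Re (?v z)) = Re (circle_mean r ?v)"
      using cont assms by (intro circle_mean_Re) auto
    also have "circle_mean r ?v = 0"
      unfolding circle_mean_cmult circle_mean_holomorphic_div_power[OF hR assms(2,3)] coeff_R by simp
    finally show ?thesis by simp
  qed
  have "circle_mean r (\<lambda>z. (cmod (f z))\<^sup>2)
      = (\<Sum>n<N. ?S f n) + circle_mean r (\<lambda>z. (cmod (R N z))\<^sup>2)"
  proof (induction N)
    case 0 show ?case by (simp add: R_def)
  next
    case (Suc N) then show ?case using step[of N] by simp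
  qed
  moreover have "0 \<le> circle_mean r (\<lambda>z. (cmod (R N z))\<^sup>2)"
    unfolding circle_mean_def by (cases "(\<lambda>t. (cmod (R N (circlepath 0 r t)))\<^sup>2) integrable_on {0..1}")
      (auto intro: integral_nonneg simp: not_integrable_integral)
  ultimately show ?thesis by simp
qed

section \<open>The scale of weighted Dirichlet spaces\<close>

text \<open>
  The energy is the square of \<open>dirichlet_norm\<close>. As a plain sum over the coefficients it splits
  along complementary sets of indices, and for
  \<open>\<alpha> = 1\<close> it is the squared norm of the Hardy space.
\<close>

abbreviation energy :: "real \<Rightarrow> (complex \<Rightarrow> complex) \<Rightarrow> real"
  where "energy \<alpha> f \<equiv> (\<Sum>n. dirichlet_term \<alpha> f n)"

lemma dirichlet_term_nonneg [simp]: "0 \<le> dirichlet_term \<alpha> f n"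
  by (simp add: dirichlet_term_def)

lemma dirichlet_term_one: "dirichlet_term 1 f = (\<lambda>n. (cmod (taylor_coeff f n))\<^sup>2)"
  by (simp add: dirichlet_term_def fun_eq_iff)

lemma dirichlet_term_antimono: "\<alpha> \<le> \<beta> \<Longrightarrow> dirichlet_term \<beta> f n \<le> dirichlet_term \<alpha> f n"
  unfolding dirichlet_term_def by (intro mult_right_mono powr_mono) auto

lemma dirichlet_space_mono: "\<alpha> \<le> \<beta> \<Longrightarrow> dirichlet_space \<alpha> \<subseteq> dirichlet_space \<beta>"
  using summable_comparison_test'[of "dirichlet_term \<alpha> f" 0 "dirichlet_term \<beta> f" for f]
  by (auto simp: dirichlet_space_def dirichlet_term_antimono)

lemma energy_nonneg: "f \<in> dirichlet_space \<alpha> \<Longrightarrow> 0 \<le> energy \<alpha> f"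
  by (auto simp: dirichlet_space_def intro: suminf_nonneg)

lemma dirichlet_norm_power2: "f \<in> dirichlet_space \<alpha> \<Longrightarrow> (dirichlet_norm \<alpha> f)\<^sup>2 = energy \<alpha> f"
  by (simp add: dirichlet_norm_def energy_nonneg)

lemma suminf_le_if_partial_sums_le:
  fixes f :: "nat \<Rightarrow> real"
  assumes "\<And>n. 0 \<le> f n" "\<And>n. (\<Sum>i<n. f i) \<le> B"
  shows "summable f" "suminf f \<le> B"
proof -
  show "summable f" by (rule summableI_nonneg_bounded) (use assms in auto)
  then show "suminf f \<le> B" by (rule suminf_le_const) (use assms in auto)
qed

lemma dirichlet_term_cong:
  assumes "\<And>z. z \<in> \<bbbD> \<Longrightarrow> f z = g z"
  shows "dirichlet_term \<alpha> f = dirichlet_term \<alpha> g"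
  using taylor_coeff_cong[OF assms] by (simp add: dirichlet_term_def fun_eq_iff)

lemma dirichlet_term_cmult:
  assumes "f holomorphic_on \<bbbD>"
  shows "dirichlet_term \<alpha> (\<lambda>z. c * f z) = (\<lambda>n. (cmod c)\<^sup>2 * dirichlet_term \<alpha> f n)"
  by (simp add: dirichlet_term_def taylor_coeff_cmult[OF assms] norm_mult power_mult_distrib fun_eq_iff)

lemma dirichlet_space_cmult:
  assumes "f \<in> dirichlet_space \<alpha>"
  shows "(\<lambda>z. c * f z) \<in> dirichlet_space \<alpha>" 
    and "energy \<alpha> (\<lambda>z. c * f z) = (cmod c)\<^sup>2 * energy \<alpha> f"
proof -
  have f: "f holomorphic_on \<bbbD>" "summable (dirichlet_term \<alpha> f)"
    using assms by (auto simp: dirichlet_space_def)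
  show "(\<lambda>z. c * f z) \<in> dirichlet_space \<alpha>" 
    using f by (auto simp: dirichlet_space_def dirichlet_term_cmult intro!: holomorphic_intros summable_mult)
  show "energy \<alpha> (\<lambda>z. c * f z) = (cmod c)\<^sup>2 * energy \<alpha> f"
    unfolding dirichlet_term_cmult[OF f(1)] by (rule suminf_mult[OF f(2)])
qed

lemma dirichlet_space_diff:
  assumes "f \<in> dirichlet_space \<alpha>" "g \<in> dirichlet_space \<alpha>"
  shows "(\<lambda>z. f z - g z) \<in> dirichlet_space \<alpha>" 
    and "energy \<alpha> (\<lambda>z. f z - g z) \<le> 2 * energy \<alpha> f + 2 * energy \<alpha> g"
proof -
  have f: "f holomorphic_on \<bbbD>" "summable (dirichlet_term \<alpha> f)"
    and g: "g holomorphic_on \<bbbD>" "summable (dirichlet_term \<alpha> g)"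
    using assms by (auto simp: dirichlet_space_def)
  let ?d = "\<lambda>z. f z - g z"
  have le: "dirichlet_term \<alpha> ?d n \<le> 2 * dirichlet_term \<alpha> f n + 2 * dirichlet_term \<alpha> g n" for n
  proof -
    let ?a = "taylor_coeff f n" and ?b = "taylor_coeff g n"
    have "(cmod (?a - ?b))\<^sup>2 \<le> (cmod ?a + cmod ?b)\<^sup>2"
      by (intro power_mono norm_triangle_ineq4 norm_ge_zero)
    also have "\<dots> \<le> 2 * (cmod ?a)\<^sup>2 + 2 * (cmod ?b)\<^sup>2"
      using sum_squares_bound[of "cmod ?a" "cmod ?b"] by (simp add: power2_sum)
    finally have "(real n + 1) powr (1 - \<alpha>) * (cmod (?a - ?b))\<^sup>2
        \<le> (real n + 1) powr (1 - \<alpha>) * (2 * (cmod ?a)\<^sup>2 + 2 * (cmod ?b)\<^sup>2)"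
      by (intro mult_left_mono) auto
    then show ?thesis
      by (simp add: dirichlet_term_def taylor_coeff_diff[OF f(1) g(1)] algebra_simps)
  qed
  have s: "summable (\<lambda>n. 2 * dirichlet_term \<alpha> f n + 2 * dirichlet_term \<alpha> g n)"
    using f g by (intro summable_add summable_mult)
  have sd: "summable (dirichlet_term \<alpha> ?d)"
    by (rule summable_comparison_test'[OF s]) (simp add: le)
  then show "?d \<in> dirichlet_space \<alpha>" 
    using f g by (auto simp: dirichlet_space_def intro!: holomorphic_intros)
  have "energy \<alpha> ?d \<le> (\<Sum>n. 2 * dirichlet_term \<alpha> f n + 2 * dirichlet_term \<alpha> g n)"
    by (rule suminf_le[OF le sd s])
  also have "\<dots> = 2 * energy \<alpha> f + 2 * energy \<alpha> g"
    using f g by (simp add: suminf_add[symmetric] suminf_mult summable_mult)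
  finally show "energy \<alpha> ?d \<le> 2 * energy \<alpha> f + 2 * energy \<alpha> g" .
qed

lemma taylor_coeff_le_energy:
  assumes "f \<in> dirichlet_space \<alpha>" "\<alpha> \<le> 1"
  shows "(cmod (taylor_coeff f n))\<^sup>2 \<le> energy \<alpha> f"
    and "cmod (taylor_coeff f n) \<le> dirichlet_norm \<alpha> f"
proof -
  have "1 * (cmod (taylor_coeff f n))\<^sup>2 \<le> dirichlet_term \<alpha> f n"
    using assms unfolding dirichlet_term_def by (intro mult_right_mono) (auto simp: ge_one_powr_ge_zero)
  also have "\<dots> \<le> energy \<alpha> f"
    using sum_le_suminf[of "dirichlet_term \<alpha> f" "{n}"] assms by (simp add: dirichlet_space_def)
  finally show 1: "(cmod (taylor_coeff f n))\<^sup>2 \<le> energy \<alpha> f" by simp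
  show "cmod (taylor_coeff f n) \<le> dirichlet_norm \<alpha> f"
    unfolding dirichlet_norm_def using 1 by (rule real_le_rsqrt)
qed

lemma dirichlet_term_finite_sum:
  assumes "finite A"
  shows "dirichlet_term \<alpha> (\<lambda>z. \<Sum>n\<in>A. taylor_coeff f n * z ^ n) m
    = (if m \<in> A then dirichlet_term \<alpha> f m else 0)"
  by (simp add: dirichlet_term_def taylor_coeff_finite_sum[OF assms])

lemma finite_sum_in_dirichlet_space:
  assumes "finite A"
  shows "(\<lambda>z. \<Sum>n\<in>A. taylor_coeff f n * z ^ n) \<in> dirichlet_space \<alpha>"
  unfolding dirichlet_space_def
  by (auto intro!: holomorphic_intros summable_finite[OF assms] simp: dirichlet_term_finite_sum[OF assms])

text \<open>
  The Hardy energy of the tail past index \<open>N\<close> is small in comparison with the full energy, since the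
  weight is at least \<open>(N + 1) powr (1 - \<beta>)\<close> there; finitely many coefficients control the rest. This is
  the compactness of the inclusion of the space in the Hardy space.
\<close>

lemma hardy_energy_split:
  assumes "f \<in> dirichlet_space \<beta>" "\<beta> < 1"
  shows "energy 1 f \<le> (real N + 1) powr (\<beta> - 1) * energy \<beta> f + (\<Sum>n<N. (cmod (taylor_coeff f n))\<^sup>2)"
proof -
  let ?a = "\<lambda>n. (cmod (taylor_coeff f n))\<^sup>2" and ?c = "(real N + 1) powr (\<beta> - 1)"
  let ?b = "\<lambda>n. if n \<in> {..<N} then ?a n else 0"
  have s: "summable (dirichlet_term \<beta> f)" using assms by (simp add: dirichlet_space_def)
  have s1: "summable (dirichlet_term 1 f)"
    using assms dirichlet_space_mono[of \<beta> 1] by (auto simp: dirichlet_space_def)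
  have "dirichlet_term 1 f n \<le> ?c * dirichlet_term \<beta> f n + ?b n" for n
  proof (cases "n < N")
    case True then show ?thesis by (simp add: dirichlet_term_one)
  next
    case False
    then have "(real N + 1) powr (1 - \<beta>) \<le> (real n + 1) powr (1 - \<beta>)"
      using assms by (intro powr_mono2) auto
    then have "?c * (real N + 1) powr (1 - \<beta>) \<le> ?c * (real n + 1) powr (1 - \<beta>)" by (intro mult_left_mono) auto
    then have "1 * ?a n \<le> ?c * (real n + 1) powr (1 - \<beta>) * ?a n"
      by (intro mult_right_mono) (simp_all add: powr_add[symmetric])
    then show ?thesis using False by (simp add: dirichlet_term_one dirichlet_term_def mult.assoc)
  qed
  then have "energy 1 f \<le> (\<Sum>n. ?c * dirichlet_term \<beta> f n + ?b n)"
    using s1 s by (intro suminf_le summable_add summable_mult summable_If_finite_set) auto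
  also have "\<dots> = ?c * energy \<beta> f + (\<Sum>n. ?b n)"
    by (subst suminf_add[symmetric]) (auto intro: summable_mult s summable_If_finite_set simp: suminf_mult s)
  also have "(\<Sum>n. ?b n) = (\<Sum>n<N. ?a n)"
    using sums_If_finite_set[of "{..<N}" ?a] by (simp add: sums_iff)
  finally show ?thesis .
qed

section \<open>Operators on weighted Dirichlet spaces\<close>

lemma linear_operator_on_scale:
  assumes "linear_operator_on \<alpha> T" "f \<in> dirichlet_space \<alpha>" "z \<in> \<bbbD>"
  shows "T (\<lambda>w. c * f w) z = c * T f z"
proof -
  have "\<forall>c. \<forall>f\<in>dirichlet_space \<alpha>. \<forall>z\<in>\<bbbD>. T (\<lambda>w. c * f w) z = c * T f z"
    using assms(1) unfolding linear_operator_on_def by simp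
  from this[rule_format, OF assms(2,3)] show ?thesis .
qed

lemma linear_operator_on_diff:
  assumes T: "linear_operator_on \<alpha> T" and f: "f \<in> dirichlet_space \<alpha>" and g: "g \<in> dirichlet_space \<alpha>"
    and z: "z \<in> \<bbbD>"
  shows "T (\<lambda>w. f w - g w) z = T f z - T g z"
proof -
  have g': "(\<lambda>w. - 1 * g w) \<in> dirichlet_space \<alpha>"
    using g unfolding dirichlet_space_def dirichlet_term_def
    by (auto simp: taylor_coeff_cmult[of g "-1", simplified] intro!: holomorphic_intros)
  have add: "\<forall>f\<in>dirichlet_space \<alpha>. \<forall>g\<in>dirichlet_space \<alpha>. \<forall>z\<in>\<bbbD>. T (\<lambda>w. f w + g w) z = T f z + T g z"
    using T unfolding linear_operator_on_def by simp
  have "T (\<lambda>w. f w + - 1 * g w) z = T f z + T (\<lambda>w. - 1 * g w) z"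
    using add[rule_format, OF f g' z] .
  also have "T (\<lambda>w. - 1 * g w) z = - 1 * T g z"
    by (rule linear_operator_on_scale[OF T g z])
  finally show ?thesis by simp
qed

text \<open>
  All the spaces for parameters at most \<open>1\<close> lie in the Hardy space, so linearity is inherited from
  there and only invariance has to be checked.
\<close>

lemma linear_operator_on_if_invariant:
  assumes "linear_operator_on 1 T" "\<beta> \<le> 1" "\<And>f. f \<in> dirichlet_space \<beta> \<Longrightarrow> T f \<in> dirichlet_space \<beta>"
  shows "linear_operator_on \<beta> T"
  using assms(1,3) dirichlet_space_mono[OF assms(2)] unfolding linear_operator_on_def by (simp add: subset_iff)

lemma bounded_operator_on_energy:
  "bounded_operator_on \<alpha> T \<longleftrightarrow>
    linear_operator_on \<alpha> T \<and> (\<exists>K>0. \<forall>f\<in>dirichlet_space \<alpha>. energy \<alpha> (T f) \<le> K * energy \<alpha> f)"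
proof (cases "linear_operator_on \<alpha> T")
  case True
  have T_in: "T f \<in> dirichlet_space \<alpha>" if "f \<in> dirichlet_space \<alpha>" for f
    using True that by (auto simp: linear_operator_on_def)
  have nonneg: "0 \<le> dirichlet_norm \<alpha> f" if "f \<in> dirichlet_space \<alpha>" for f
    using energy_nonneg[OF that] by (simp add: dirichlet_norm_def)
  have "\<exists>K>0. \<forall>f\<in>dirichlet_space \<alpha>. energy \<alpha> (T f) \<le> K * energy \<alpha> f"
    if K: "\<forall>f\<in>dirichlet_space \<alpha>. dirichlet_norm \<alpha> (T f) \<le> K * dirichlet_norm \<alpha> f" for K
  proof (intro exI[of _ "K\<^sup>2 + 1"] conjI ballI)
    show "0 < K\<^sup>2 + 1" by (simp add: add_nonneg_pos)
    fix f assume f: "f \<in> dirichlet_space \<alpha>"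
    have "energy \<alpha> (T f) = (dirichlet_norm \<alpha> (T f))\<^sup>2" by (simp add: dirichlet_norm_power2 T_in f)
    also have "\<dots> \<le> (K * dirichlet_norm \<alpha> f)\<^sup>2"
      using K f nonneg[OF T_in[OF f]] by (intro power_mono) auto
    also have "\<dots> = K\<^sup>2 * energy \<alpha> f" by (simp add: power_mult_distrib dirichlet_norm_power2 f)
    also have "\<dots> \<le> (K\<^sup>2 + 1) * energy \<alpha> f" using energy_nonneg[OF f] by (simp add: algebra_simps)
    finally show "energy \<alpha> (T f) \<le> (K\<^sup>2 + 1) * energy \<alpha> f" .
  qed
  moreover have "\<exists>K. \<forall>f\<in>dirichlet_space \<alpha>. dirichlet_norm \<alpha> (T f) \<le> K * dirichlet_norm \<alpha> f"
    if K: "\<forall>f\<in>dirichlet_space \<alpha>. energy \<alpha> (T f) \<le> K * energy \<alpha> f" for K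
  proof (intro exI[of _ "sqrt K"] ballI)
    fix f assume "f \<in> dirichlet_space \<alpha>"
    then have "sqrt (energy \<alpha> (T f)) \<le> sqrt (K * energy \<alpha> f)" using K by simp
    then show "dirichlet_norm \<alpha> (T f) \<le> sqrt K * dirichlet_norm \<alpha> f"
      by (simp add: dirichlet_norm_def real_sqrt_mult)
  qed
  ultimately show ?thesis using True unfolding bounded_operator_on_def by blast
qed (simp add: bounded_operator_on_def)

section \<open>Weighted composition operators on the Hardy space\<close>

text \<open>
  Write \<open>pCons a p\<close> as \<open>a + z p\<close>. Since \<open>\<phi>\<close> has modulus at most \<open>1\<close>, composing with \<open>\<phi>\<close> and averaging
  the square gives at most \<open>|a|\<^sup>2 + 2 Re (cnj a * \<phi> 0 * p (\<phi> 0))\<close> plus the mean for \<open>p\<close>: the mixed term is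
  harmonic, hence equal to its value at the centre. If \<open>\<phi> 0 = 0\<close> it vanishes and induction yields the
  constant \<open>1\<close>. In general the subtracted term \<open>\<rho> |p (\<phi> 0)|\<^sup>2\<close>, carried through the induction, absorbs it
  by completing a square, and the constant is the one of Harnack's inequality.
\<close>

lemma littlewood_subordination_poly:
  assumes "self_map \<phi>" "0 < r" "r < 1"
  defines "\<rho> \<equiv> cmod (\<phi> 0)"
  shows "circle_mean r (\<lambda>z. (cmod (poly p (\<phi> z)))\<^sup>2)
    \<le> (1 + \<rho>) / (1 - \<rho>) * (\<Sum>n\<le>degree p. (cmod (coeff p n))\<^sup>2) - \<rho> * (cmod (poly p (\<phi> 0)))\<^sup>2"
proof (induction p)
  case 0
  show ?case by simp
next
  case (pCons a p)
  have phi: "\<phi> holomorphic_on \<bbbD>" "\<And>z. z \<in> \<bbbD> \<Longrightarrow> cmod (\<phi> z) < 1"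
    using assms(1) by (auto simp: self_map_def image_subset_iff)
  then have \<rho>: "0 \<le> \<rho>" "\<rho> < 1" by (auto simp: \<rho>_def)
  let ?g = "\<lambda>z. poly p (\<phi> z)" and ?C = "(1 + \<rho>) / (1 - \<rho>)" and ?w = "\<phi> 0"
  have hg: "?g holomorphic_on \<bbbD>" "(\<lambda>z. \<phi> z * ?g z) holomorphic_on \<bbbD>"
    using holomorphic_on_compose_gen[OF phi(1) holomorphic_on_poly[of p UNIV]] phi(1)
    by (auto simp: o_def intro: holomorphic_intros)
  have cont: "continuous_on (sphere 0 r) \<phi>" "continuous_on (sphere 0 r) ?g"
    by (rule continuous_on_subset[OF holomorphic_on_imp_continuous_on];
        use phi hg assms in auto)+
  have "circle_mean r (\<lambda>z. (cmod (poly (pCons a p) (\<phi> z)))\<^sup>2)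
      \<le> circle_mean r (\<lambda>z. (cmod a)\<^sup>2 + 2 * Re (cnj a * (\<phi> z * ?g z)) + (cmod (?g z))\<^sup>2)"
  proof (rule circle_mean_mono)
    fix z :: complex assume "cmod z = r"
    then have "cmod (\<phi> z) \<le> 1" using phi assms by (simp add: less_imp_le)
    then have "cmod (\<phi> z * ?g z) \<le> cmod (?g z)"
      by (simp add: norm_mult mult_left_le_one_le)
    then show "(cmod (poly (pCons a p) (\<phi> z)))\<^sup>2
        \<le> (cmod a)\<^sup>2 + 2 * Re (cnj a * (\<phi> z * ?g z)) + (cmod (?g z))\<^sup>2"
      by (simp add: cmod_add_power2)
  qed (use assms in \<open>auto intro!: continuous_intros cont\<close>)
  also have "\<dots> = (cmod a)\<^sup>2 + 2 * circle_mean r (\<lambda>z. Re (cnj a * (\<phi> z * ?g z)))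
      + circle_mean r (\<lambda>z. (cmod (?g z))\<^sup>2)"
    using assms cont by (simp add: circle_mean_add circle_mean_cmult continuous_intros del: times_complex.sel)
  also have "circle_mean r (\<lambda>z. Re (cnj a * (\<phi> z * ?g z))) = Re (cnj a * (?w * ?g 0))"
    using circle_mean_Re[of r "\<lambda>z. cnj a * (\<phi> z * ?g z)"] cont assms
      circle_mean_holomorphic[OF hg(2) assms(2,3)]
    by (simp add: circle_mean_cmult continuous_intros)
  finally have 1: "circle_mean r (\<lambda>z. (cmod (poly (pCons a p) (\<phi> z)))\<^sup>2)
    \<le> (cmod a)\<^sup>2 + 2 * Re (cnj a * (?w * ?g 0)) + circle_mean r (\<lambda>z. (cmod (?g z))\<^sup>2)" .
  have 2: "(\<Sum>n\<le>degree (pCons a p). (cmod (coeff (pCons a p) n))\<^sup>2)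
      = (cmod a)\<^sup>2 + (\<Sum>n\<le>degree p. (cmod (coeff p n))\<^sup>2)"
    using pCons.hyps by (cases "p = 0") (simp_all add: sum.atMost_Suc_shift del: sum.atMost_Suc)
  let ?x = "cmod a" and ?y = "cmod (?g 0)"
  have 3: "(1 + \<rho>) * ?x\<^sup>2 + (1 + \<rho>) * (2 * Re (cnj a * (?w * ?g 0))) - \<rho> * (1 - \<rho>\<^sup>2) * ?y\<^sup>2
     \<le> ?C * ?x\<^sup>2"
  proof -
    \<comment> \<open>Completing the square in \<open>y\<close>; the coefficient \<open>\<rho>\<close> of the subtracted term is the
      choice for which the outcome is exactly the constant \<open>?C\<close>.\<close>
    have eq: "(1 + \<rho>) * x\<^sup>2 + (1 + \<rho>) * (2 * (x * (\<rho> * y))) - \<rho> * (1 - \<rho>\<^sup>2) * y\<^sup>2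
        = ?C * (x\<^sup>2 - \<rho> * (x - (1 - \<rho>) * y)\<^sup>2)" for x y :: real
    proof -
      have "(1 - \<rho>) * ((1 + \<rho>) * x\<^sup>2 + (1 + \<rho>) * (2 * (x * (\<rho> * y))) - \<rho> * (1 - \<rho>\<^sup>2) * y\<^sup>2)
        = (1 + \<rho>) * (x\<^sup>2 - \<rho> * (x - (1 - \<rho>) * y)\<^sup>2)"
        by algebra
      then show ?thesis using \<rho> by (simp add: eq_divide_eq mult.commute)
    qed
    have "Re (cnj a * (?w * ?g 0)) \<le> ?x * (\<rho> * ?y)"
      using complex_Re_le_cmod[of "cnj a * (?w * ?g 0)"] by (simp add: norm_mult \<rho>_def)
    then have "(1 + \<rho>) * ?x\<^sup>2 + (1 + \<rho>) * (2 * Re (cnj a * (?w * ?g 0))) - \<rho> * (1 - \<rho>\<^sup>2) * ?y\<^sup>2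
      \<le> (1 + \<rho>) * ?x\<^sup>2 + (1 + \<rho>) * (2 * (?x * (\<rho> * ?y))) - \<rho> * (1 - \<rho>\<^sup>2) * ?y\<^sup>2"
      using \<rho> by (auto intro!: mult_left_mono)
    also have "\<dots> = ?C * (?x\<^sup>2 - \<rho> * (?x - (1 - \<rho>) * ?y)\<^sup>2)"
      using eq by blast
    also have "\<dots> \<le> ?C * ?x\<^sup>2"
      using \<rho> by (intro mult_left_mono) auto
    finally show ?thesis .
  qed
  have 4: "(cmod (poly (pCons a p) ?w))\<^sup>2 = ?x\<^sup>2 + 2 * Re (cnj a * (?w * ?g 0)) + \<rho>\<^sup>2 * ?y\<^sup>2"
    by (simp only: poly_pCons cmod_add_power2 norm_mult power_mult_distrib \<rho>_def)
  have arith: "M \<le> c * (X + S) - \<rho> * (X + T + \<rho>\<^sup>2 * Y)"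
    if "M \<le> X + T + M'" "(1 + \<rho>) * X + (1 + \<rho>) * T - \<rho> * (1 - \<rho>\<^sup>2) * Y \<le> c * X"
      "M' \<le> c * S - \<rho> * Y" for M M' X T Y S c :: real
    using that by (simp add: algebra_simps)
  show ?case
    unfolding 2 4 by (rule arith[OF 1 3 pCons.IH])
qed

text \<open>
  On the circle \<open>\<phi>\<close> stays in a compact disc of radius less than \<open>1\<close>, where the Taylor polynomials are
  bounded uniformly, so the polynomial case passes to the limit by dominated convergence.
\<close>

lemma littlewood_subordination:
  assumes phi: "self_map \<phi>" and f: "f \<in> dirichlet_space 1" and r: "0 < r" "r < 1"
  shows "circle_mean r (\<lambda>z. (cmod (f (\<phi> z)))\<^sup>2) \<le> (1 + cmod (\<phi> 0)) / (1 - cmod (\<phi> 0)) * energy 1 f"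
proof -
  let ?a = "taylor_coeff f" and ?C = "(1 + cmod (\<phi> 0)) / (1 - cmod (\<phi> 0))"
  have holf: "f holomorphic_on \<bbbD>" and S: "summable (\<lambda>n. (cmod (?a n))\<^sup>2)"
    using f by (auto simp: dirichlet_space_def dirichlet_term_one)
  have ph: "\<phi> holomorphic_on \<bbbD>" "\<And>z. z \<in> \<bbbD> \<Longrightarrow> cmod (\<phi> z) < 1"
    using phi by (auto simp: self_map_def image_subset_iff)
  have C: "0 \<le> ?C" using ph(2)[of 0] by simp
  define p where "p N = (\<Sum>n<N. monom (?a n) n)" for N
  have poly_p: "poly (p N) w = (\<Sum>n<N. ?a n * w ^ n)" for N w
    by (simp add: p_def poly_sum poly_monom)
  have coeff_p: "coeff (p N) n = (if n < N then ?a n else 0)" for N n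
    by (simp add: p_def coeff_sum)
  have cont: "continuous_on (sphere 0 r) \<phi>"
    by (rule continuous_on_subset[OF holomorphic_on_imp_continuous_on[OF ph(1)]]) (use r in auto)
  have ne: "sphere (0::complex) r \<noteq> {}" using r by auto
  obtain z0 where z0: "z0 \<in> sphere 0 r" "\<And>z. z \<in> sphere 0 r \<Longrightarrow> cmod (\<phi> z) \<le> cmod (\<phi> z0)"
    using continuous_attains_sup[OF compact_sphere ne continuous_on_norm[OF cont]] by blast
  define R where "R = cmod (\<phi> z0)"
  have R: "0 \<le> R" "R < 1" using ph(2)[of z0] z0(1) r by (auto simp: R_def)
  \<comment> \<open>A point strictly between the circle of radius \<open>R\<close> and the unit circle: convergence there
    gives absolute convergence on the circle of radius \<open>R\<close>.\<close>
  define x where "x = complex_of_real ((1 + R) / 2)"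
  have x: "cmod x = (1 + R) / 2" using R by (simp add: x_def norm_divide del: of_real_add of_real_divide)
  have sR: "summable (\<lambda>n. norm (?a n * complex_of_real R ^ n))"
    by (rule powser_insidea[of _ x]) (use sums_summable[OF taylor_sums[OF holf, of x]] x R in auto)
  then have sR: "summable (\<lambda>n. cmod (?a n) * R ^ n)"
    using R by (simp add: norm_mult norm_power)
  define B where "B = (\<Sum>n. cmod (?a n) * R ^ n)"
  have bound: "cmod (poly (p N) w) \<le> B" if "cmod w \<le> R" for N w
  proof -
    have "cmod (poly (p N) w) \<le> (\<Sum>n<N. cmod (?a n) * R ^ n)"
      unfolding poly_p by (rule order.trans[OF norm_sum])
        (use that in \<open>auto simp: norm_mult norm_power intro!: sum_mono mult_left_mono power_mono\<close>)
    also have "\<dots> \<le> B"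
      unfolding B_def by (rule sum_le_suminf[OF sR]) (use R in auto)
    finally show ?thesis .
  qed
  have "(\<lambda>N. circle_mean r (\<lambda>z. (cmod (poly (p N) (\<phi> z)))\<^sup>2)) \<longlonglongrightarrow> circle_mean r (\<lambda>z. (cmod (f (\<phi> z)))\<^sup>2)"
    unfolding circle_mean_def
  proof (rule dominated_convergence(2)[where h = "\<lambda>_. B\<^sup>2"])
    fix N
    have "continuous_on (sphere 0 r) (\<lambda>z. (cmod (poly (p N) (\<phi> z)))\<^sup>2)"
      by (intro continuous_intros cont)
    then show "(\<lambda>t. (cmod (poly (p N) (\<phi> (circlepath 0 r t))))\<^sup>2) integrable_on {0..1}"
      by (rule circle_integrable) (use r in auto)
    fix t
    let ?z = "circlepath 0 r t"
    have z: "?z \<in> sphere 0 r" using r by (simp add: circlepath_in_sphere)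
    have "cmod (poly (p N) (\<phi> ?z)) \<le> B"
      by (rule bound) (use z0(2)[OF z] in \<open>simp add: R_def\<close>)
    then show "norm ((cmod (poly (p N) (\<phi> ?z)))\<^sup>2) \<le> B\<^sup>2"
      by (simp add: power_mono)
  next
    fix t
    let ?z = "circlepath 0 r t"
    have "\<phi> ?z \<in> \<bbbD>" using ph(2)[of ?z] r by (simp add: circlepath_in_sphere)
    then have "(\<lambda>N. poly (p N) (\<phi> ?z)) \<longlonglongrightarrow> f (\<phi> ?z)"
      using taylor_sums[OF holf] unfolding sums_def poly_p by blast
    then show "(\<lambda>N. (cmod (poly (p N) (\<phi> ?z)))\<^sup>2) \<longlonglongrightarrow> (cmod (f (\<phi> ?z)))\<^sup>2"
      by (intro tendsto_intros)
  qed auto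
  then show ?thesis
  proof (rule tendsto_upperbound, intro always_eventually allI)
    fix N
    have "circle_mean r (\<lambda>z. (cmod (poly (p N) (\<phi> z)))\<^sup>2)
        \<le> ?C * (\<Sum>n\<le>degree (p N). (cmod (coeff (p N) n))\<^sup>2)"
      using littlewood_subordination_poly[OF phi r, of "p N"] 
      by (smt (verit) mult_nonneg_nonneg norm_ge_zero zero_le_power2)
    moreover have "(\<Sum>n\<le>degree (p N). (cmod (coeff (p N) n))\<^sup>2) \<le> (\<Sum>n\<le>degree (p N). (cmod (?a n))\<^sup>2)"
      by (intro sum_mono) (simp add: coeff_p)
    then have "(\<Sum>n\<le>degree (p N). (cmod (coeff (p N) n))\<^sup>2) \<le> energy 1 f"
      unfolding dirichlet_term_one using sum_le_suminf[OF S, of "{..degree (p N)}"] by simp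
    ultimately show "circle_mean r (\<lambda>z. (cmod (poly (p N) (\<phi> z)))\<^sup>2) \<le> ?C * energy 1 f"
      using mult_left_mono[OF _ C] order.trans by blast
  qed simp
qed

lemma weighted_comp_holomorphic:
  assumes "self_map \<phi>" "\<psi> holomorphic_on \<bbbD>" "f holomorphic_on \<bbbD>"
  shows "weighted_comp \<psi> \<phi> f holomorphic_on \<bbbD>"
proof -
  have "(f \<circ> \<phi>) holomorphic_on \<bbbD>"
    using assms by (intro holomorphic_on_compose_gen[of _ _ _ \<bbbD>]) (auto simp: self_map_def)
  then show ?thesis
    unfolding weighted_comp_def using assms(2) by (auto intro!: holomorphic_intros simp: o_def)
qed

text \<open>
  Bessel's inequality on the circle of radius \<open>r\<close> turns the bound on the mean of \<open>|f \<circ> \<phi>|\<^sup>2\<close> into one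
  on the Taylor coefficients damped by \<open>r\<close>, uniformly in \<open>r\<close>; then let \<open>r\<close> tend to \<open>1\<close>.
\<close>

lemma weighted_comp_hardy:
  assumes phi: "self_map \<phi>" and psi: "\<psi> holomorphic_on \<bbbD>"
    and B: "\<And>z. z \<in> \<bbbD> \<Longrightarrow> cmod (\<psi> z) \<le> B"
    and f: "f \<in> dirichlet_space 1"
  shows "weighted_comp \<psi> \<phi> f \<in> dirichlet_space 1"
    and "energy 1 (weighted_comp \<psi> \<phi> f)
      \<le> B\<^sup>2 * ((1 + cmod (\<phi> 0)) / (1 - cmod (\<phi> 0))) * energy 1 f"
proof -
  let ?T = "weighted_comp \<psi> \<phi> f" and ?C = "(1 + cmod (\<phi> 0)) / (1 - cmod (\<phi> 0))"
  have holf: "f holomorphic_on \<bbbD>" using f by (simp add: dirichlet_space_def)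
  have holT: "?T holomorphic_on \<bbbD>" by (rule weighted_comp_holomorphic[OF phi psi holf])
  have holc: "(\<lambda>z. f (\<phi> z)) holomorphic_on \<bbbD>"
    using weighted_comp_holomorphic[OF phi _ holf, of "\<lambda>_. 1"] by (simp add: weighted_comp_def)
  have r_bound: "(\<Sum>n<N. (cmod (taylor_coeff ?T n))\<^sup>2 * r ^ (2 * n)) \<le> B\<^sup>2 * ?C * energy 1 f"
    if r: "0 < r" "r < 1" for N r
  proof -
    have cont: "continuous_on (sphere 0 r) ?T" "continuous_on (sphere 0 r) (\<lambda>z. f (\<phi> z))"
      by (rule continuous_on_subset[OF holomorphic_on_imp_continuous_on]; use holT holc r in auto)+
    have "(\<Sum>n<N. (cmod (taylor_coeff ?T n))\<^sup>2 * r ^ (2 * n)) \<le> circle_mean r (\<lambda>z. (cmod (?T z))\<^sup>2)"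
      by (rule bessel_circle_mean[OF holT r])
    also have "\<dots> \<le> circle_mean r (\<lambda>z. B\<^sup>2 * (cmod (f (\<phi> z)))\<^sup>2)"
    proof (rule circle_mean_mono)
      fix z :: complex assume "cmod z = r"
      then have "cmod (\<psi> z) \<le> B" using B[of z] r by simp
      then show "(cmod (?T z))\<^sup>2 \<le> B\<^sup>2 * (cmod (f (\<phi> z)))\<^sup>2"
        by (simp add: weighted_comp_def norm_mult power_mult_distrib mult_right_mono power_mono)
    qed (use r in \<open>auto intro!: continuous_intros cont\<close>)
    also have "\<dots> \<le> B\<^sup>2 * (?C * energy 1 f)"
      unfolding circle_mean_cmult using littlewood_subordination[OF phi f r] by (intro mult_left_mono) auto
    finally show ?thesis by (simp add: mult.assoc)
  qed
  have "(\<Sum>n<N. dirichlet_term 1 ?T n) \<le> B\<^sup>2 * ?C * energy 1 f" for N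
  proof -
    have "((\<lambda>r. \<Sum>n<N. (cmod (taylor_coeff ?T n))\<^sup>2 * r ^ (2 * n))
        \<longlongrightarrow> (\<Sum>n<N. (cmod (taylor_coeff ?T n))\<^sup>2 * 1 ^ (2 * n))) (at_left (1::real))"
      by (intro tendsto_intros)
    then have lim: "((\<lambda>r. \<Sum>n<N. (cmod (taylor_coeff ?T n))\<^sup>2 * r ^ (2 * n))
        \<longlongrightarrow> (\<Sum>n<N. (cmod (taylor_coeff ?T n))\<^sup>2)) (at_left (1::real))" by simp
    have ev: "\<forall>\<^sub>F r in at_left (1::real).
        (\<Sum>n<N. (cmod (taylor_coeff ?T n))\<^sup>2 * r ^ (2 * n)) \<le> B\<^sup>2 * ?C * energy 1 f"
      by (rule eventually_mono[OF eventually_at_left_real[of 0 1] r_bound]) auto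
    show ?thesis
      unfolding dirichlet_term_one[of ?T] by (rule tendsto_upperbound[OF lim ev]) simp
  qed
  from suminf_le_if_partial_sums_le[OF _ this] show "?T \<in> dirichlet_space 1"
    "energy 1 ?T \<le> B\<^sup>2 * ?C * energy 1 f"
    using holT by (auto simp: dirichlet_space_def)
qed

text \<open>
  For \<open>h t = \<psi> (t z) + (1 - t) z \<psi>' (t z)\<close> the first derivatives of \<open>\<psi>\<close> cancel in \<open>h'\<close>, leaving
  \<open>(1 - t) z\<^sup>2 \<psi>'' (t z)\<close>. The factor \<open>1 - t\<close> is at most \<open>1 - |t z|\<^sup>2\<close>, so the hypothesis bounds \<open>h'\<close>, and
  \<open>h 1 - h 0\<close> is the difference of \<open>\<psi> z\<close> and its first-order Taylor polynomial.
\<close>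

lemma bounded_if_second_derivative_growth:
  assumes psi: "\<psi> holomorphic_on \<bbbD>"
    and bdd: "bdd_above ((\<lambda>z. cmod (deriv (deriv \<psi>) z) * (1 - (cmod z)\<^sup>2)) ` \<bbbD>)"
  obtains B where "\<And>z. z \<in> \<bbbD> \<Longrightarrow> cmod (\<psi> z) \<le> B"
proof -
  obtain M where M: "\<And>z. z \<in> \<bbbD> \<Longrightarrow> cmod (deriv (deriv \<psi>) z) * (1 - (cmod z)\<^sup>2) \<le> M"
    using bdd by (meson bdd_above.E imageI)
  have d1: "deriv \<psi> holomorphic_on \<bbbD>" using psi by (intro holomorphic_deriv) auto
  have "cmod (\<psi> z) \<le> cmod (\<psi> 0) + cmod (deriv \<psi> 0) + M" if z: "z \<in> \<bbbD>" for z
  proof -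
    define h where "h t = \<psi> (t * z) + (1 - t) * z * deriv \<psi> (t * z)" for t
    let ?S = "closed_segment 0 (1::complex)"
    have S: "\<exists>s. t = complex_of_real s \<and> 0 \<le> s \<and> s \<le> 1" if "t \<in> ?S" for t
      using that by (auto simp: closed_segment_def scaleR_conv_of_real)
    have tz: "t * z \<in> \<bbbD>" if "t \<in> ?S" for t
    proof -
      have "cmod t \<le> 1" using S[OF that] by auto
      then have "cmod t * cmod z \<le> cmod z" by (simp add: mult_left_le_one_le)
      then show ?thesis using z by (simp add: norm_mult)
    qed
    have "cmod (h 1 - h 0) \<le> M * cmod (1 - 0)"
    proof (rule field_differentiable_bound[where S = ?S])
      fix t assume t: "t \<in> ?S"
      have D: "(\<psi> has_field_derivative deriv \<psi> (t * z)) (at (t * z))"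
        "(deriv \<psi> has_field_derivative deriv (deriv \<psi>) (t * z)) (at (t * z))"
        using holomorphic_derivI[OF psi _ tz[OF t]] holomorphic_derivI[OF d1 _ tz[OF t]] by auto
      have "(h has_field_derivative
          deriv \<psi> (t * z) * z + ((1 - t) * z * (deriv (deriv \<psi>) (t * z) * z)
            + - z * deriv \<psi> (t * z))) (at t within ?S)"
        unfolding h_def
        by (rule DERIV_chain2[where g = "\<lambda>t. t * z", OF D(1)] DERIV_chain2[where g = "\<lambda>t. t * z", OF D(2)]
              derivative_eq_intros refl | simp)+
      then show "(h has_field_derivative (1 - t) * z\<^sup>2 * deriv (deriv \<psi>) (t * z)) (at t within ?S)"
        by (simp add: algebra_simps power2_eq_square)
      obtain s where s: "t = complex_of_real s" "0 \<le> s" "s \<le> 1" using S[OF t] by auto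
      have "(cmod (t * z))\<^sup>2 \<le> s"
      proof -
        have "(cmod (t * z))\<^sup>2 = s\<^sup>2 * (cmod z)\<^sup>2" using s by (simp add: norm_mult power_mult_distrib)
        also have "\<dots> \<le> s * 1"
          using s z by (intro mult_mono) (auto simp: power2_eq_square mult_left_le_one_le mult_le_one)
        finally show ?thesis by simp
      qed
      moreover have "(cmod z)\<^sup>2 \<le> 1" using z by (simp add: power_le_one)
      moreover have "cmod (1 - t) = 1 - s"
        using s by (metis abs_of_nonneg diff_ge_0_iff_ge norm_of_real of_real_1 of_real_diff)
      ultimately have "cmod ((1 - t) * z\<^sup>2 * deriv (deriv \<psi>) (t * z))
          \<le> (1 - (cmod (t * z))\<^sup>2) * 1 * cmod (deriv (deriv \<psi>) (t * z))"
        unfolding norm_mult norm_power using s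
        by (intro mult_right_mono mult_mono) auto
      also have "\<dots> \<le> M" using M[OF tz[OF t]] by (simp add: mult.commute)
      finally show "cmod ((1 - t) * z\<^sup>2 * deriv (deriv \<psi>) (t * z)) \<le> M" .
    qed auto
    then have "cmod (\<psi> z - (\<psi> 0 + z * deriv \<psi> 0)) \<le> M" by (simp add: h_def)
    moreover have "cmod (z * deriv \<psi> 0) \<le> cmod (deriv \<psi> 0)"
      using z by (simp add: norm_mult mult_left_le_one_le)
    ultimately show ?thesis
      by (smt (verit) norm_triangle_ineq norm_triangle_sub)
  qed
  then show ?thesis using that by blast
qed

text \<open>
  Near the boundary the limit gives the bound, and the remaining compact disc is covered by continuity.
\<close>

lemma bdd_above_if_vanishing_at_boundary:
  assumes psi: "\<psi> holomorphic_on \<bbbD>"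
    and lim: "((\<lambda>z. cmod (deriv (deriv \<psi>) z) * (1 - (cmod z)\<^sup>2)) \<longlongrightarrow> 0) (filtercomap cmod (at_left 1))"
  shows "bdd_above ((\<lambda>z. cmod (deriv (deriv \<psi>) z) * (1 - (cmod z)\<^sup>2)) ` \<bbbD>)"
proof -
  let ?u = "\<lambda>z. cmod (deriv (deriv \<psi>) z) * (1 - (cmod z)\<^sup>2)"
  have "\<forall>\<^sub>F z in filtercomap cmod (at_left 1). ?u z < 1"
    using order_tendstoD(2)[OF lim, of 1] by simp
  then obtain b where b: "b < 1" "\<And>z. b < cmod z \<Longrightarrow> cmod z < 1 \<Longrightarrow> ?u z < 1"
    unfolding eventually_filtercomap eventually_at_left[OF zero_less_one] by blast
  have "continuous_on \<bbbD> ?u"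
    using psi by (intro continuous_intros holomorphic_on_imp_continuous_on holomorphic_deriv) auto
  then have "continuous_on (cball 0 b) ?u"
    by (rule continuous_on_subset) (use b in auto)
  then have "bounded (?u ` cball 0 b)"
    by (intro compact_imp_bounded compact_continuous_image) auto
  then obtain K where K: "\<And>z. z \<in> cball 0 b \<Longrightarrow> ?u z \<le> K"
    by (meson bounded_imp_bdd_above bdd_above.E imageI)
  have "?u z \<le> max K 1" if "z \<in> \<bbbD>" for z
    using K[of z] b(2)[of z] that by (cases "cmod z \<le> b") auto
  then show ?thesis by (rule bdd_aboveI2)
qed

lemma weighted_comp_bounded_on_hardy:
  assumes phi: "self_map \<phi>" and psi: "\<psi> holomorphic_on \<bbbD>"
    and bdd: "bdd_above ((\<lambda>z. cmod (deriv (deriv \<psi>) z) * (1 - (cmod z)\<^sup>2)) ` \<bbbD>)"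
  shows "bounded_operator_on 1 (weighted_comp \<psi> \<phi>)"
proof -
  obtain B where B: "\<And>z. z \<in> \<bbbD> \<Longrightarrow> cmod (\<psi> z) \<le> B"
    using bounded_if_second_derivative_growth[OF psi bdd] by blast
  let ?K = "B\<^sup>2 * ((1 + cmod (\<phi> 0)) / (1 - cmod (\<phi> 0)))"
  have "cmod (\<phi> 0) < 1" using phi by (auto simp: self_map_def image_subset_iff)
  then have "0 \<le> ?K" by simp
  show ?thesis
    unfolding bounded_operator_on_energy
  proof (intro conjI exI[of _ "?K + 1"] ballI)
    show "linear_operator_on 1 (weighted_comp \<psi> \<phi>)"
      using weighted_comp_hardy(1)[OF phi psi B]
      by (auto simp: linear_operator_on_def weighted_comp_def algebra_simps)
    show "0 < ?K + 1" using \<open>0 \<le> ?K\<close> by linarith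
    fix f assume f: "f \<in> dirichlet_space 1"
    have "energy 1 (weighted_comp \<psi> \<phi> f) \<le> ?K * energy 1 f"
      by (rule weighted_comp_hardy(2)[OF phi psi B f])
    also have "\<dots> \<le> (?K + 1) * energy 1 f"
      using energy_nonneg[OF f] by (intro mult_right_mono) auto
    finally show "energy 1 (weighted_comp \<psi> \<phi> f) \<le> (?K + 1) * energy 1 f" .
  qed
qed

section \<open>Interpolation between a Dirichlet space and the Hardy space\<close>

text \<open>
  Up to the scale \<open>2 ^ j = x\<close> the terms grow geometrically with ratio \<open>2 powr s > 1\<close>, beyond it they decay
  with ratio \<open>2 powr s / 2 < 1\<close>, so the sum is comparable to its largest term, of size \<open>x powr s\<close>.

  The proof avoids locating that scale. With \<open>q = 2 powr s\<close> the partial sums satisfy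
  \<open>S (n + 1) x = min 1 x + q * S n (x / 2)\<close>, and the function equal to \<open>E x\<close> for \<open>x \<le> 1\<close> and to
  \<open>C x powr s - D\<close> for \<open>x \<ge> 1\<close> is a supersolution of this recursion. The subtracted \<open>D\<close> is what
  absorbs the \<open>1\<close> added in each step.
\<close>

lemma dyadic_sum_upper:
  fixes s :: real
  assumes s: "0 < s" "s < 1"
  obtains C where "0 < C"
    and "\<And>x n. 0 \<le> x \<Longrightarrow> (\<Sum>j<n. (2 powr s) ^ j * min 1 (x / 2 ^ j)) \<le> C * x powr s"
proof -
  define q where "q = 2 powr s"
  have q: "1 < q" "q < 2"
    using s powr_less_mono[of 0 s 2] powr_less_mono[of s 1 2] by (auto simp: q_def)
  define E where "E = 2 / (2 - q)"
  define D where "D = 1 / (q - 1)"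
  \<comment> \<open>\<open>E\<close> solves \<open>x + q * (E * x / 2) = E * x\<close>, and \<open>D\<close> solves \<open>1 - q * D = - D\<close>. The constant
    \<open>C\<close> is large enough for \<open>1 \<le> x < 2\<close>, where a step passes from the second regime to the first.\<close>
  define C where "C = 1 + D + q * E"
  have E: "0 < E" "1 + q * E / 2 = E" and D: "0 < D" "1 - q * D = - D"
    using q by (auto simp: E_def D_def field_simps)
  have "E \<le> q * E" using E(1) q(1) by simp
  moreover have "0 < q * E" using E(1) q(1) by simp
  ultimately have C: "0 < C" "D \<le> C" "E \<le> C" "1 + q * E = C - D"
    using D(1) unfolding C_def by linarith+
  let ?S = "\<lambda>n x. \<Sum>j<n. q ^ j * min 1 (x / 2 ^ j)"
  have S_Suc: "?S (Suc n) x = min 1 x + q * ?S n (x / 2)" for n x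
    by (subst sum.lessThan_Suc_shift) (simp add: sum_distrib_left mult.assoc)
  have half: "q * (x / 2) powr s = x powr s" if "0 \<le> x" for x
    using that by (simp add: q_def powr_divide)
  have main: "0 \<le> x \<Longrightarrow> (x \<le> 1 \<longrightarrow> ?S n x \<le> E * x) \<and> (1 \<le> x \<longrightarrow> ?S n x \<le> C * x powr s - D)" for n x
  proof (induction n arbitrary: x)
    case 0
    have "D * 1 \<le> C * x powr s" if "1 \<le> x"
      using that C D s by (intro mult_mono) (auto simp: ge_one_powr_ge_zero)
    then show ?case using 0 E by auto
  next
    case (Suc n)
    have IH: "x / 2 \<le> 1 \<Longrightarrow> ?S n (x / 2) \<le> E * (x / 2)"
      "1 \<le> x / 2 \<Longrightarrow> ?S n (x / 2) \<le> C * (x / 2) powr s - D"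
      using Suc.IH[of "x / 2"] Suc.prems by auto
    have "?S (Suc n) x \<le> E * x" if "x \<le> 1"
    proof -
      have "?S (Suc n) x \<le> x + q * (E * (x / 2))"
        unfolding S_Suc using IH(1) that q by (intro add_mono mult_left_mono) auto
      also have "\<dots> = (1 + q * E / 2) * x" by (simp add: algebra_simps)
      finally show ?thesis by (simp add: E(2))
    qed
    moreover have "?S (Suc n) x \<le> C * x powr s - D" if "1 \<le> x"
    proof (cases "1 \<le> x / 2")
      case True
      have "?S (Suc n) x \<le> 1 + q * (C * (x / 2) powr s - D)"
        unfolding S_Suc using IH(2) True q by (intro add_mono mult_left_mono) auto
      also have "\<dots> = C * (q * (x / 2) powr s) + (1 - q * D)" by (simp add: algebra_simps)
      finally show ?thesis using half[of x] Suc.prems D(2) by simp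
    next
      case False
      have "?S n (x / 2) \<le> E * 1"
        using IH(1) False E(1) by (intro order.trans[OF IH(1) mult_left_mono]) auto
      then have "?S (Suc n) x \<le> 1 + q * E"
        unfolding S_Suc using q by (intro add_mono mult_left_mono) auto
      moreover have "C * 1 \<le> C * x powr s"
        using that C s by (intro mult_left_mono) (auto simp: ge_one_powr_ge_zero)
      ultimately show ?thesis using C(4) by simp
    qed
    ultimately show ?case by blast
  qed
  have "?S n x \<le> C * x powr s" if x: "0 \<le> x" for n x
  proof (cases "x \<le> 1")
    case True
    have "x \<le> x powr s"
      using powr_mono'[of s 1 x] s x True by simp
    then have "E * x \<le> C * x powr s" using E(1) C x by (intro mult_mono) auto
    then show ?thesis using main[OF x, of n] True by simp
  next
    case False
    then show ?thesis using main[OF x, of n] D(1) by simp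
  qed
  then show ?thesis using that[OF C(1)] by (simp add: q_def)
qed

text \<open>
  Already the term with \<open>2 ^ j \<le> w < 2 ^ (j + 1)\<close> is large enough.
\<close>

lemma dyadic_term_lower:
  fixes s w :: real
  assumes s: "0 < s" "s < 1" and w: "1 \<le> w"
  shows "\<exists>j. w powr s \<le> 2 * ((2 powr s) ^ j * min 1 (w / 2 ^ j))"
proof -
  define j where "j = (LEAST j. w < 2 ^ Suc j)"
  obtain n where "w < 2 ^ n" using real_arch_pow[of 2 w] by auto
  then have "w < 2 ^ Suc n" by (simp add: less_le_trans)
  then have up: "w < 2 ^ Suc j" unfolding j_def by (rule LeastI)
  have low: "2 ^ j \<le> w"
  proof (cases j)
    case (Suc i)
    then have "\<not> w < 2 ^ Suc i" using not_less_Least[of i "\<lambda>j. w < 2 ^ Suc j"] by (simp add: j_def)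
    then show ?thesis using Suc by simp
  qed (use w in simp)
  have "w powr s \<le> (2 ^ Suc j) powr s"
    using up w s by (intro powr_mono2) auto
  also have "\<dots> = (2 powr s) ^ Suc j"
    by (simp add: powr_mult powr_power[symmetric] powr_realpow[symmetric] powr_powr mult.commute)
  also have "\<dots> \<le> 2 * (2 powr s) ^ j"
    using s powr_mono[of s 1 2] by simp
  finally show ?thesis using low by (intro exI[of _ j]) (simp add: min_def)
qed

text \<open>
  The sum \<open>\<Sum>m. min 1 (w m / 2 ^ j) * B m\<close> is comparable to the square of the K-functional at the
  scale \<open>2 ^ j\<close>. Multiplied by \<open>2 powr (j * s)\<close> and summed over \<open>j\<close>, it becomes the norm with weight
  \<open>w powr s\<close>. So a bound between K-functionals, at arguments that differ by a factor \<open>\<delta>\<close>, becomes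
  one between the interpolated norms, with constant \<open>\<delta> powr s\<close>. The term with \<open>L\<close> stays unweighted
  on the right because the sum of \<open>(2 powr s / 2) ^ j\<close> converges, by the case \<open>x = 1\<close> of the assumption on \<open>C\<close>.
\<close>

lemma interpolation_sums:
  fixes A B w :: "nat \<Rightarrow> real"
  assumes s: "0 < s" "s < 1"
    and C: "\<And>x n. 0 \<le> x \<Longrightarrow> (\<Sum>j<n. (2 powr s) ^ j * min 1 (x / 2 ^ j)) \<le> C * x powr s"
    and w: "\<And>n. 1 \<le> w n" and A: "\<And>n. 0 \<le> A n" and B: "\<And>n. 0 \<le> B n"
    and nonneg: "0 \<le> \<delta>" "0 \<le> K" "0 \<le> L"
    and sumA: "summable (\<lambda>n. w n powr s * A n)"
    and le: "\<And>j M. (\<Sum>m<M. min 1 (w m / 2 ^ j) * B m)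
      \<le> K * (\<Sum>n. min 1 (\<delta> * w n / 2 ^ j) * A n) + L / 2 ^ j * (\<Sum>n. A n)"
  shows "summable (\<lambda>n. w n powr s * B n)"
    and "(\<Sum>n. w n powr s * B n) \<le> 2 * C * (K * \<delta> powr s * (\<Sum>n. w n powr s * A n) + L * (\<Sum>n. A n))"
proof -
  let ?q = "2 powr s :: real" and ?Ks = "\<lambda>j n. min 1 (\<delta> * w n / 2 ^ j) * A n"
  have sA: "summable A"
  proof (rule summable_comparison_test'[OF sumA])
    fix n
    have "1 * A n \<le> w n powr s * A n"
      using w s A by (intro mult_right_mono) (auto simp: ge_one_powr_ge_zero)
    then show "norm (A n) \<le> w n powr s * A n" using A by simp
  qed
  have sK: "summable (?Ks j)" for j
  proof (rule summable_comparison_test'[OF sA])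
    fix n
    have "0 \<le> \<delta> * w n / 2 ^ j" using nonneg w[of n] by simp
    then show "norm (?Ks j n) \<le> A n" using A by (simp add: mult_left_le_one_le)
  qed
  have C0: "0 \<le> C" using C[of 1 0] by simp
  have bound: "(\<Sum>m<M. w m powr s * B m)
      \<le> 2 * C * (K * \<delta> powr s * (\<Sum>n. w n powr s * A n) + L * (\<Sum>n. A n))" for M
  proof -
    obtain j where j: "\<And>m. w m powr s \<le> 2 * (?q ^ j m * min 1 (w m / 2 ^ j m))"
      using dyadic_term_lower[OF s w] by metis
    define J where "J = Suc (Max (j ` {..<M}))"
    have jJ: "j m < J" if "m < M" for m using that by (auto simp: J_def less_Suc_eq_le)
    have "(\<Sum>m<M. w m powr s * B m) \<le> (\<Sum>m<M. 2 * (\<Sum>i<J. ?q ^ i * min 1 (w m / 2 ^ i)) * B m)"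
    proof (intro sum_mono mult_right_mono B)
      fix m assume "m \<in> {..<M}"
      then have "?q ^ j m * min 1 (w m / 2 ^ j m) \<le> (\<Sum>i<J. ?q ^ i * min 1 (w m / 2 ^ i))"
        using jJ w by (intro member_le_sum) (auto intro!: mult_nonneg_nonneg divide_nonneg_nonneg order.trans[OF zero_le_one w])
      then show "w m powr s \<le> 2 * (\<Sum>i<J. ?q ^ i * min 1 (w m / 2 ^ i))" using j[of m] by simp
    qed
    also have "\<dots> = 2 * (\<Sum>i<J. ?q ^ i * (\<Sum>m<M. min 1 (w m / 2 ^ i) * B m))"
      unfolding sum_distrib_left sum_distrib_right by (subst sum.swap) (simp add: mult_ac)
    also have "\<dots> \<le> 2 * (\<Sum>i<J. ?q ^ i * (K * (\<Sum>n. ?Ks i n) + L / 2 ^ i * (\<Sum>n. A n)))"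
      by (intro mult_left_mono sum_mono le) auto
    also have "\<dots> = 2 * (K * (\<Sum>i<J. ?q ^ i * (\<Sum>n. ?Ks i n)) + L * (\<Sum>i<J. ?q ^ i * min 1 (1 / 2 ^ i)) * (\<Sum>n. A n))"
    proof -
      have "min 1 (1 / 2 ^ i) = (1 / 2 ^ i :: real)" for i by (rule min_absorb2) simp
      then show ?thesis
        by (simp add: sum_distrib_left sum_distrib_right sum.distrib algebra_simps)
    qed
    also have "\<dots> \<le> 2 * (K * (C * \<delta> powr s * (\<Sum>n. w n powr s * A n)) + L * C * (\<Sum>n. A n))"
    proof -
      have "(\<Sum>i<J. ?q ^ i * (\<Sum>n. ?Ks i n)) = (\<Sum>n. \<Sum>i<J. ?q ^ i * ?Ks i n)"
        by (subst suminf_sum) (auto intro: summable_mult sK simp: suminf_mult sK)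
      also have "\<dots> \<le> (\<Sum>n. C * \<delta> powr s * (w n powr s * A n))"
      proof (rule suminf_le)
        fix n
        have "(\<Sum>i<J. ?q ^ i * ?Ks i n) = (\<Sum>i<J. ?q ^ i * min 1 (\<delta> * w n / 2 ^ i)) * A n"
          by (subst sum_distrib_right) (simp add: mult_ac)
        also have "\<dots> \<le> C * (\<delta> * w n) powr s * A n"
          using nonneg w[of n] by (intro mult_right_mono C A) auto
        finally show "(\<Sum>i<J. ?q ^ i * ?Ks i n) \<le> C * \<delta> powr s * (w n powr s * A n)"
          using nonneg w[of n] by (simp add: powr_mult mult_ac)
      qed (auto intro!: summable_sum summable_mult sK sumA)
      also have "\<dots> = C * \<delta> powr s * (\<Sum>n. w n powr s * A n)" by (rule suminf_mult[OF sumA])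
      finally have "(\<Sum>i<J. ?q ^ i * (\<Sum>n. ?Ks i n)) \<le> C * \<delta> powr s * (\<Sum>n. w n powr s * A n)" .
      moreover have "(\<Sum>i<J. ?q ^ i * min 1 (1 / 2 ^ i)) \<le> C" using C[of 1 J] by simp
      moreover have "0 \<le> (\<Sum>n. A n)" using sA A by (rule suminf_nonneg)
      ultimately show ?thesis
        using nonneg by (intro mult_left_mono add_mono mult_right_mono) auto
    qed
    finally show ?thesis by (simp add: algebra_simps)
  qed
  show "summable (\<lambda>n. w n powr s * B n)"
    "(\<Sum>n. w n powr s * B n) \<le> 2 * C * (K * \<delta> powr s * (\<Sum>n. w n powr s * A n) + L * (\<Sum>n. A n))"
    using suminf_le_if_partial_sums_le[OF _ bound] B by auto
qed

text \<open>
  At the scale \<open>2 ^ j\<close> the function \<open>f\<close> is cut at the index where \<open>\<delta> * w n\<close> passes \<open>2 ^ j\<close>. This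
  cut makes the two bounds add up to a K-functional: on the polynomial part
  \<open>\<delta> * w n / 2 ^ j\<close> is the smaller argument of the minimum, on the remainder \<open>1\<close> is. The
  coefficients of the image of the polynomial are weighted by \<open>w m / 2 ^ j\<close>, those of the image
  of the remainder by \<open>1\<close>.

  The factor \<open>\<delta>\<close> measures by how much the operator is better on the space for \<open>\<alpha>\<close> than on the Hardy
  space, and \<open>L\<close> makes room for the lower-order term by which compactness is expressed.
\<close>

lemma energy_interpolation:
  fixes T :: "(complex \<Rightarrow> complex) \<Rightarrow> complex \<Rightarrow> complex"
  assumes \<alpha>\<beta>: "\<alpha> < \<beta>" "\<beta> < 1"
    and C: "\<And>x n. 0 \<le> x \<Longrightarrow> (\<Sum>j<n. (2 powr ((1 - \<beta>) / (1 - \<alpha>))) ^ j * min 1 (x / 2 ^ j))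
      \<le> C * x powr ((1 - \<beta>) / (1 - \<alpha>))"
    and lin: "linear_operator_on 1 T"
    and const: "0 < \<delta>" "0 \<le> K" "0 \<le> L"
    and T1: "\<And>f. f \<in> dirichlet_space 1 \<Longrightarrow> energy 1 (T f) \<le> K * energy 1 f"
    and T\<alpha>: "\<And>f. f \<in> dirichlet_space \<alpha> \<Longrightarrow> T f \<in> dirichlet_space \<alpha>"
      "\<And>f. f \<in> dirichlet_space \<alpha> \<Longrightarrow> energy \<alpha> (T f) \<le> K * \<delta> * energy \<alpha> f + L * energy 1 f"
    and f: "f \<in> dirichlet_space \<beta>"
  shows "T f \<in> dirichlet_space \<beta>"
    and "energy \<beta> (T f) \<le> 4 * C * (K * \<delta> powr ((1 - \<beta>) / (1 - \<alpha>)) * energy \<beta> f + L * energy 1 f)"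
proof -
  let ?s = "(1 - \<beta>) / (1 - \<alpha>)"
  define w where "w n = (real n + 1) powr (1 - \<alpha>)" for n
  let ?a = "\<lambda>n. (cmod (taylor_coeff f n))\<^sup>2"
  have s: "0 < ?s" "?s < 1" using \<alpha>\<beta> by auto
  have w: "1 \<le> w n" for n using \<alpha>\<beta> by (auto simp: w_def ge_one_powr_ge_zero)
  have term_\<alpha>: "dirichlet_term \<alpha> h = (\<lambda>n. w n * (cmod (taylor_coeff h n))\<^sup>2)" for h
    by (simp add: dirichlet_term_def w_def fun_eq_iff)
  have term_\<beta>: "dirichlet_term \<beta> h = (\<lambda>n. w n powr ?s * (cmod (taylor_coeff h n))\<^sup>2)" for h
    using \<alpha>\<beta> by (simp add: dirichlet_term_def w_def fun_eq_iff powr_powr)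
  have f1: "f \<in> dirichlet_space 1" using f dirichlet_space_mono[of \<beta> 1] \<alpha>\<beta> by auto
  have holf: "f holomorphic_on \<bbbD>" using f by (simp add: dirichlet_space_def)
  have T_in: "T h \<in> dirichlet_space 1" if "h \<in> dirichlet_space 1" for h
    using lin that by (simp add: linear_operator_on_def)
  have hol_T: "T h holomorphic_on \<bbbD>" if "h \<in> dirichlet_space 1" for h
    using T_in[OF that] by (simp add: dirichlet_space_def)
  have sa: "summable ?a" using f1 by (simp add: dirichlet_space_def dirichlet_term_one)
  have w_lim: "filterlim w at_top sequentially"
    unfolding w_def using \<alpha>\<beta> by real_asymp
  have le: "(\<Sum>m<M. min 1 (w m / 2 ^ j) * (cmod (taylor_coeff (T f) m))\<^sup>2)
      \<le> 2 * K * (\<Sum>n. min 1 (\<delta> * w n / 2 ^ j) * ?a n) + 2 * L / 2 ^ j * (\<Sum>n. ?a n)" for j M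
  proof -
    let ?A = "{n. \<delta> * w n \<le> 2 ^ j}"
    have "finite ?A"
    proof -
      have "eventually (\<lambda>n. 2 ^ j / \<delta> < w n) sequentially"
        using w_lim by (simp add: filterlim_at_top_dense)
      then obtain N where "\<And>n. N \<le> n \<Longrightarrow> 2 ^ j / \<delta> < w n"
        by (auto simp: eventually_sequentially)
      then have "?A \<subseteq> {..<N}" using const by (auto simp: field_simps not_le[symmetric])
      then show ?thesis using finite_subset by blast
    qed
    define low where "low z = (\<Sum>n\<in>?A. taylor_coeff f n * z ^ n)" for z
    define high where "high z = f z - low z" for z
    note low_in = finite_sum_in_dirichlet_space[OF \<open>finite ?A\<close>, of f, folded low_def[abs_def]]
    have coeff_low: "taylor_coeff low n = (if n \<in> ?A then taylor_coeff f n else 0)" for n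
      unfolding low_def by (rule taylor_coeff_finite_sum) fact
    have hol: "low holomorphic_on \<bbbD>" using low_in by (simp add: dirichlet_space_def)
    have coeff_high: "taylor_coeff high n = (if n \<in> ?A then 0 else taylor_coeff f n)" for n
      unfolding high_def by (simp add: taylor_coeff_diff[OF holf hol] coeff_low)
    have high_in: "high \<in> dirichlet_space 1"
    proof -
      have "summable (dirichlet_term 1 high)"
        by (rule summable_comparison_test'[OF sa]) (simp add: dirichlet_term_one coeff_high)
      moreover have "high holomorphic_on \<bbbD>" unfolding high_def by (intro holomorphic_intros holf hol)
      ultimately show ?thesis by (simp add: dirichlet_space_def)
    qed
    have split: "taylor_coeff (T f) m = taylor_coeff (T high) m + taylor_coeff (T low) m" for m
    proof -
      have "taylor_coeff (T f) m = taylor_coeff (\<lambda>z. T high z + T low z) m"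
      proof (rule taylor_coeff_cong)
        fix z :: complex assume "z \<in> \<bbbD>"
        then show "T f z = T high z + T low z"
          using linear_operator_on_diff[OF lin f1 low_in] by (simp add: high_def[abs_def])
      qed
      then show ?thesis by (simp add: taylor_coeff_add[OF hol_T[OF high_in] hol_T[OF low_in]])
    qed
    let ?h = "\<lambda>m. (cmod (taylor_coeff (T high) m))\<^sup>2" and ?l = "\<lambda>m. (cmod (taylor_coeff (T low) m))\<^sup>2"
    have "(\<Sum>m<M. min 1 (w m / 2 ^ j) * (cmod (taylor_coeff (T f) m))\<^sup>2)
        \<le> (\<Sum>m<M. 2 * ?h m + 2 / 2 ^ j * (w m * ?l m))"
    proof (rule sum_mono)
      fix m
      let ?m = "min 1 (w m / 2 ^ j)"
      have m: "0 \<le> ?m" "?m \<le> 1" "?m \<le> w m / 2 ^ j" using w[of m] by auto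
      have "(cmod (taylor_coeff (T f) m))\<^sup>2 \<le> (cmod (taylor_coeff (T high) m) + cmod (taylor_coeff (T low) m))\<^sup>2"
        unfolding split by (intro power_mono norm_triangle_ineq norm_ge_zero)
      also have "\<dots> \<le> 2 * ?h m + 2 * ?l m"
        using sum_squares_bound[of "cmod (taylor_coeff (T high) m)" "cmod (taylor_coeff (T low) m)"]
        by (simp add: power2_sum)
      finally have "?m * (cmod (taylor_coeff (T f) m))\<^sup>2 \<le> ?m * (2 * ?h m + 2 * ?l m)"
        using m by (intro mult_left_mono)
      also have "\<dots> = ?m * (2 * ?h m) + ?m * (2 * ?l m)" by (simp add: distrib_left)
      also have "\<dots> \<le> 1 * (2 * ?h m) + w m / 2 ^ j * (2 * ?l m)"
        using m by (intro add_mono mult_right_mono) auto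
      finally show "?m * (cmod (taylor_coeff (T f) m))\<^sup>2 \<le> 2 * ?h m + 2 / 2 ^ j * (w m * ?l m)"
        by (simp add: mult_ac)
    qed
    also have "\<dots> = 2 * (\<Sum>m<M. dirichlet_term 1 (T high) m) + 2 / 2 ^ j * (\<Sum>m<M. dirichlet_term \<alpha> (T low) m)"
      by (simp add: sum.distrib sum_distrib_left dirichlet_term_one term_\<alpha>)
    also have "\<dots> \<le> 2 * energy 1 (T high) + 2 / 2 ^ j * energy \<alpha> (T low)"
      using T_in[OF high_in] T\<alpha>(1)[OF low_in]
      by (intro add_mono mult_left_mono sum_le_suminf) (auto simp: dirichlet_space_def)
    also have "\<dots> \<le> 2 * (K * energy 1 high) + 2 / 2 ^ j * (K * \<delta> * energy \<alpha> low + L * energy 1 f)"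
    proof -
      have "summable (dirichlet_term 1 low)" "summable (dirichlet_term 1 f)"
        using low_in f1 by (simp_all add: dirichlet_space_def)
      moreover have "dirichlet_term 1 low n \<le> dirichlet_term 1 f n" for n
        by (simp add: dirichlet_term_one coeff_low)
      ultimately have "energy 1 low \<le> energy 1 f" by (intro suminf_le)
      then have "L * energy 1 low \<le> L * energy 1 f" using const by (intro mult_left_mono)
      then have "energy \<alpha> (T low) \<le> K * \<delta> * energy \<alpha> low + L * energy 1 f"
        using T\<alpha>(2)[OF low_in] by linarith
      then show ?thesis using T1[OF high_in] by (intro add_mono mult_left_mono) auto
    qed
    also have "\<dots> = 2 * K * (energy 1 high + \<delta> / 2 ^ j * energy \<alpha> low) + 2 * L / 2 ^ j * energy 1 f"
      by (simp add: algebra_simps)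
    also have "energy 1 high + \<delta> / 2 ^ j * energy \<alpha> low = (\<Sum>n. min 1 (\<delta> * w n / 2 ^ j) * ?a n)"
    proof -
      have "summable (dirichlet_term 1 high)" "summable (\<lambda>n. \<delta> / 2 ^ j * dirichlet_term \<alpha> low n)"
        "summable (dirichlet_term \<alpha> low)"
        using high_in low_in by (auto simp: dirichlet_space_def intro: summable_mult)
      then have "energy 1 high + \<delta> / 2 ^ j * energy \<alpha> low
          = (\<Sum>n. dirichlet_term 1 high n + \<delta> / 2 ^ j * dirichlet_term \<alpha> low n)"
        by (simp only: suminf_mult[symmetric] suminf_add)
      also have "\<dots> = (\<Sum>n. min 1 (\<delta> * w n / 2 ^ j) * ?a n)"
        by (rule suminf_cong) (auto simp: dirichlet_term_one term_\<alpha> coeff_low coeff_high min_def field_simps)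
      finally show ?thesis .
    qed
    finally show ?thesis by (simp add: dirichlet_term_one)
  qed
  have "summable (\<lambda>n. w n powr ?s * ?a n)" using f by (simp add: dirichlet_space_def term_\<beta>)
  note * = interpolation_sums[OF s C w _ _ _ _ _ this le]
  show "T f \<in> dirichlet_space \<beta>"
    using *(1) const hol_T[OF f1] by (simp add: dirichlet_space_def term_\<beta>)
  have "energy \<beta> (T f) \<le> 2 * C * (2 * K * \<delta> powr ?s * energy \<beta> f + 2 * L * energy 1 f)"
    using *(2) const unfolding term_\<beta> dirichlet_term_one by simp
  then show "energy \<beta> (T f) \<le> 4 * C * (K * \<delta> powr ?s * energy \<beta> f + L * energy 1 f)"
    by (simp add: algebra_simps)
qed

text \<open>
  The factor \<open>\<delta>\<close> is the quotient of the two operator bounds, so that \<open>K1 * \<delta>\<close> is the bound for \<open>\<alpha>\<close>; there is no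
  lower-order term.
\<close>

theorem bounded_interpolation:
  assumes \<alpha>\<beta>: "\<alpha> < \<beta>" "\<beta> < 1"
    and T1: "bounded_operator_on 1 T" and T\<alpha>: "bounded_operator_on \<alpha> T"
  shows "bounded_operator_on \<beta> T"
proof -
  let ?s = "(1 - \<beta>) / (1 - \<alpha>)"
  obtain K1 where lin: "linear_operator_on 1 T" and K1: "0 < K1"
    "\<And>f. f \<in> dirichlet_space 1 \<Longrightarrow> energy 1 (T f) \<le> K1 * energy 1 f"
    using T1 unfolding bounded_operator_on_energy by blast
  obtain K where lin\<alpha>: "linear_operator_on \<alpha> T" and K: "0 < K"
    "\<And>f. f \<in> dirichlet_space \<alpha> \<Longrightarrow> energy \<alpha> (T f) \<le> K * energy \<alpha> f"
    using T\<alpha> unfolding bounded_operator_on_energy by blast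
  have s: "0 < ?s" "?s < 1" using \<alpha>\<beta> by auto
  obtain C where C: "0 < C"
    "\<And>x n. 0 \<le> x \<Longrightarrow> (\<Sum>j<n. (2 powr ?s) ^ j * min 1 (x / 2 ^ j)) \<le> C * x powr ?s"
    using dyadic_sum_upper[OF s] by blast
  have T_in: "\<And>f. f \<in> dirichlet_space \<alpha> \<Longrightarrow> T f \<in> dirichlet_space \<alpha>"
    using lin\<alpha> by (simp add: linear_operator_on_def)
  have \<delta>: "0 < K / K1" and K1': "0 \<le> K1" using K K1 by auto
  have est: "energy \<alpha> (T f) \<le> K1 * (K / K1) * energy \<alpha> f + 0 * energy 1 f" if "f \<in> dirichlet_space \<alpha>" for f
    using K(2)[OF that] K1(1) by simp
  note * = energy_interpolation[OF \<alpha>\<beta> C(2) lin \<delta> K1' order.refl K1(2) T_in est]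
  show ?thesis
    unfolding bounded_operator_on_energy
  proof (intro conjI linear_operator_on_if_invariant[OF lin] exI ballI)
    show "0 < 4 * C * (K1 * (K / K1) powr ?s)" using C K K1 by simp
    show "energy \<beta> (T f) \<le> 4 * C * (K1 * (K / K1) powr ?s) * energy \<beta> f" if "f \<in> dirichlet_space \<beta>" for f
      using *(2)[OF _ _ _ _ that] by (simp add: mult.assoc)
  qed (use \<alpha>\<beta> *(1) in auto)
qed

section \<open>Interpolation of compactness\<close>

lemma tendsto_zero_if_le:
  fixes u :: "nat \<Rightarrow> real"
  assumes "\<And>k. 0 \<le> u k"
    and "\<And>\<epsilon>. 0 < \<epsilon> \<Longrightarrow> \<exists>v. v \<longlonglongrightarrow> 0 \<and> (\<forall>k. u k \<le> \<epsilon> + v k)"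
  shows "u \<longlonglongrightarrow> 0"
proof (rule order_tendstoI)
  fix a :: real assume "a < 0"
  then show "\<forall>\<^sub>F k in sequentially. a < u k" using assms(1) by (auto intro: always_eventually less_le_trans)
next
  fix a :: real assume a: "0 < a"
  obtain v where v: "v \<longlonglongrightarrow> 0" "\<And>k. u k \<le> a / 2 + v k" using assms(2)[of "a / 2"] a by auto
  have "\<forall>\<^sub>F k in sequentially. v k < a / 2" using a by (intro order_tendstoD(2)[OF v(1)]) simp
  then show "\<forall>\<^sub>F k in sequentially. u k < a"
  proof eventually_elim
    case (elim k) then show ?case using v(2)[of k] by simp
  qed
qed

text \<open>
  If the estimate failed for every \<open>L\<close>, there would be functions with images of norm \<open>1\<close>, bounded norms,
  and Hardy norms tending to \<open>0\<close>. By boundedness on the Hardy space every Taylor coefficient of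
  the images tends to \<open>0\<close>, so the only possible limit in norm of a subsequence of the images is \<open>0\<close>,
  which contradicts the normalisation.
\<close>

lemma compact_imp_hardy_estimate:
  assumes comp: "compact_operator_on \<alpha> T" and \<alpha>: "\<alpha> \<le> 1"
    and T1: "\<And>f. f \<in> dirichlet_space 1 \<Longrightarrow> T f \<in> dirichlet_space 1"
      "\<And>f. f \<in> dirichlet_space 1 \<Longrightarrow> energy 1 (T f) \<le> K * energy 1 f"
    and K: "0 \<le> K" and \<delta>: "0 < \<delta>"
  obtains L where "0 \<le> L"
    "\<And>f. f \<in> dirichlet_space \<alpha> \<Longrightarrow> energy \<alpha> (T f) \<le> \<delta> * energy \<alpha> f + L * energy 1 f"
proof (rule ccontr)
  have lin: "linear_operator_on \<alpha> T" using comp by (simp add: compact_operator_on_def)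
  have T_in: "T f \<in> dirichlet_space \<alpha>" if "f \<in> dirichlet_space \<alpha>" for f
    using lin that by (auto simp: linear_operator_on_def)
  note sub = dirichlet_space_mono[OF \<alpha>, THEN subsetD]
  assume "\<not> thesis"
  then have "\<exists>f\<in>dirichlet_space \<alpha>. \<delta> * energy \<alpha> f + real k * energy 1 f < energy \<alpha> (T f)" for k
    using that[of "real k"] by (meson not_le of_nat_0_le_iff)
  then obtain f where f: "\<And>k. f k \<in> dirichlet_space \<alpha>"
    "\<And>k. \<delta> * energy \<alpha> (f k) + real k * energy 1 (f k) < energy \<alpha> (T (f k))" by metis
  define E where "E k = energy \<alpha> (T (f k))" for k
  have nonneg: "0 \<le> energy \<alpha> (f k)" "0 \<le> energy 1 (f k)" for k
    using f(1) sub by (auto intro!: energy_nonneg)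
  have E: "0 < E k" for k
    using f(2)[of k] mult_nonneg_nonneg[OF less_imp_le[OF \<delta>] nonneg(1)[of k]]
      mult_nonneg_nonneg[OF of_nat_0_le_iff[of k] nonneg(2)[of k]] unfolding E_def by linarith
  \<comment> \<open>The violated estimate is strict, so the images are nonzero and can be normalised.\<close>
  define F where "F k z = complex_of_real (1 / sqrt (E k)) * f k z" for k z
  have F_in: "F k \<in> dirichlet_space \<alpha>" for k
    unfolding F_def by (rule dirichlet_space_cmult(1)[OF f(1)])
  have scale: "(cmod (complex_of_real (1 / sqrt (E k))))\<^sup>2 = 1 / E k" for k
    using E[of k] by (simp add: norm_divide power_divide)
  have F_energy: "energy \<alpha> (F k) = energy \<alpha> (f k) / E k" "energy 1 (F k) = energy 1 (f k) / E k" for k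
    unfolding F_def dirichlet_space_cmult(2)[OF f(1)] dirichlet_space_cmult(2)[OF sub[OF f(1)]] scale
    by simp_all
  have TF: "energy \<alpha> (T (F k)) = 1" for k
  proof -
    have eq: "T (F k) z = complex_of_real (1 / sqrt (E k)) * T (f k) z" if "z \<in> \<bbbD>" for z
    proof -
      have "F k = (\<lambda>z. complex_of_real (1 / sqrt (E k)) * f k z)" by (simp add: F_def fun_eq_iff)
      then show ?thesis by (simp only: linear_operator_on_scale[OF lin f(1) that])
    qed
    have "energy \<alpha> (T (F k)) = energy \<alpha> (\<lambda>z. complex_of_real (1 / sqrt (E k)) * T (f k) z)"
      by (simp only: dirichlet_term_cong[OF eq])
    also have "\<dots> = 1"
      unfolding dirichlet_space_cmult(2)[OF T_in[OF f(1)]] scale using E[of k] by (simp add: E_def)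
    finally show ?thesis .
  qed
  have "dirichlet_norm \<alpha> (F k) \<le> sqrt (1 / \<delta>)" for k
  proof -
    have "\<delta> * energy \<alpha> (f k) \<le> E k"
      using f(2)[of k] mult_nonneg_nonneg[OF of_nat_0_le_iff[of k] nonneg(2)[of k]] by (simp add: E_def)
    then have "energy \<alpha> (F k) \<le> 1 / \<delta>"
      using E[of k] \<delta> by (simp add: F_energy field_simps)
    then show ?thesis by (simp add: dirichlet_norm_def)
  qed
  then obtain g r where g: "g \<in> dirichlet_space \<alpha>" and r: "strict_mono r"
    and lim: "(\<lambda>k. dirichlet_norm \<alpha> (\<lambda>z. T (F (r k)) z - g z)) \<longlonglongrightarrow> 0"
    using comp F_in unfolding compact_operator_on_def by blast
  have hol: "T (F k) holomorphic_on \<bbbD>" "g holomorphic_on \<bbbD>" for k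
    using T_in[OF F_in] g by (auto simp: dirichlet_space_def)
  have "(\<lambda>k. energy 1 (T (F (r k)))) \<longlonglongrightarrow> 0"
  proof (rule Lim_null_comparison)
    show "\<forall>\<^sub>F k in sequentially. norm (energy 1 (T (F (r k)))) \<le> K * (1 / real k)"
      using eventually_gt_at_top[of 0]
    proof eventually_elim
      case (elim k)
      have k: "0 < k" "k \<le> r k" using elim seq_suble[OF r] by auto
      have "real k * energy 1 (f (r k)) \<le> real (r k) * energy 1 (f (r k))"
        using k nonneg by (intro mult_right_mono) auto
      also have "\<dots> \<le> E (r k)"
        using f(2)[of "r k"] mult_nonneg_nonneg[OF less_imp_le[OF \<delta>] nonneg(1)[of "r k"]] by (simp add: E_def)
      finally have "energy 1 (F (r k)) \<le> 1 / real k"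
        using E[of "r k"] k by (simp add: F_energy field_simps)
      then have "energy 1 (T (F (r k))) \<le> K * (1 / real k)"
        using order.trans[OF T1(2)[OF sub[OF F_in]] mult_left_mono[OF _ K]] by blast
      then show ?case using energy_nonneg[OF T1(1)[OF sub[OF F_in]]] by simp
    qed
    show "(\<lambda>k. K * (1 / real k)) \<longlonglongrightarrow> 0" by real_asymp
  qed
  from tendsto_real_sqrt[OF this] have sqrt_lim: "(\<lambda>k. sqrt (energy 1 (T (F (r k))))) \<longlonglongrightarrow> 0"
    unfolding real_sqrt_zero .
  have coeff_TF: "(\<lambda>k. taylor_coeff (T (F (r k))) n) \<longlonglongrightarrow> 0" for n
    by (rule Lim_null_comparison[OF always_eventually sqrt_lim])
      (auto intro!: real_le_rsqrt taylor_coeff_le_energy T1 sub[OF F_in])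
  have coeff_g: "taylor_coeff g n = 0" for n
  proof -
    have "(\<lambda>k. taylor_coeff (\<lambda>z. T (F (r k)) z - g z) n) \<longlonglongrightarrow> 0"
      by (rule Lim_null_comparison[OF always_eventually lim])
        (auto intro!: taylor_coeff_le_energy \<alpha> dirichlet_space_diff T_in F_in g)
    then have "(\<lambda>k. taylor_coeff (T (F (r k))) n - taylor_coeff g n) \<longlonglongrightarrow> 0"
      by (simp add: taylor_coeff_diff[OF hol])
    from tendsto_diff[OF coeff_TF[of n] this] show ?thesis by (simp add: LIMSEQ_const_iff)
  qed
  have "dirichlet_norm \<alpha> (\<lambda>z. T (F (r k)) z - g z) = 1" for k
  proof -
    have "dirichlet_term \<alpha> (\<lambda>z. T (F (r k)) z - g z) = dirichlet_term \<alpha> (T (F (r k)))"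
      by (simp add: dirichlet_term_def taylor_coeff_diff[OF hol] coeff_g fun_eq_iff)
    then show ?thesis using TF by (simp add: dirichlet_norm_def)
  qed
  then show False using lim by (simp add: LIMSEQ_const_iff)
qed

text \<open>
  A bounded sequence has a subsequence whose Taylor coefficients all converge. The limits are the coefficients
  of a function \<open>f\<close> in the space, and the differences to \<open>f\<close> tend to \<open>0\<close> in the Hardy norm while they stay
  bounded in the space itself. The estimate then makes their images tend to \<open>0\<close>.
\<close>

lemma compact_if_hardy_estimate:
  assumes lin: "linear_operator_on \<beta> T" and \<beta>: "\<beta> < 1"
    and est: "\<And>\<epsilon>. 0 < \<epsilon> \<Longrightarrow> \<exists>L. \<forall>f\<in>dirichlet_space \<beta>. energy \<beta> (T f) \<le> \<epsilon> * energy \<beta> f + L * energy 1 f"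
  shows "compact_operator_on \<beta> T"
  unfolding compact_operator_on_def
proof (intro conjI lin allI impI, elim conjE exE)
  fix F :: "nat \<Rightarrow> complex \<Rightarrow> complex" and M
  assume "\<forall>k. F k \<in> dirichlet_space \<beta>" "\<forall>k. dirichlet_norm \<beta> (F k) \<le> M"
  then have F: "F k \<in> dirichlet_space \<beta>" "dirichlet_norm \<beta> (F k) \<le> M" for k by auto
  have T_in: "T f \<in> dirichlet_space \<beta>" if "f \<in> dirichlet_space \<beta>" for f
    using lin that by (auto simp: linear_operator_on_def)
  have hol: "F k holomorphic_on \<bbbD>" for k using F by (auto simp: dirichlet_space_def)
  have F_energy: "energy \<beta> (F k) \<le> M\<^sup>2" for k
    unfolding dirichlet_norm_power2[OF F(1), symmetric]
    using F(2)[of k] energy_nonneg[OF F(1)] by (intro power_mono) (auto simp: dirichlet_norm_def)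
  have coeff_F: "norm (taylor_coeff (F k) n) \<le> M" for k n
    using order.trans[OF taylor_coeff_le_energy(2)[OF F(1)] F(2)] \<beta> by simp
  obtain r where r: "strict_mono r" "\<And>n. \<exists>l. (\<lambda>k. taylor_coeff (F (r k)) n) \<longlonglongrightarrow> l"
    using function_convergent_subsequence[of "UNIV :: nat set" "\<lambda>k n. taylor_coeff (F k) n" M] coeff_F by auto
  then obtain a where a: "\<And>n. (\<lambda>k. taylor_coeff (F (r k)) n) \<longlonglongrightarrow> a n" by metis
  have a_le: "norm (a n) \<le> M" for n
    by (rule tendsto_upperbound[OF tendsto_norm[OF a]]) (auto simp: coeff_F)
  define f where "f z = (\<Sum>n. a n * z ^ n)" for z
  have f_sums: "(\<lambda>n. a n * z ^ n) sums f z" if "z \<in> \<bbbD>" for z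
    unfolding f_def
  proof (rule summable_sums, rule summable_comparison_test')
    show "summable (\<lambda>n. M * cmod z ^ n)" using that by (intro summable_mult summable_geometric) auto
    show "norm (a n * z ^ n) \<le> M * cmod z ^ n" for n
      using a_le by (simp add: norm_mult norm_power mult_right_mono)
  qed
  have coeff_f: "taylor_coeff f n = a n" for n
    by (rule taylor_coeff_power_series(1)[OF f_sums])
  have hol_f: "f holomorphic_on \<bbbD>"
    by (rule taylor_coeff_power_series(2)[OF f_sums])
  have "(\<Sum>n<N. dirichlet_term \<beta> f n) \<le> M\<^sup>2" for N
  proof (rule tendsto_upperbound)
    show "(\<lambda>k. \<Sum>n<N. dirichlet_term \<beta> (F (r k)) n) \<longlonglongrightarrow> (\<Sum>n<N. dirichlet_term \<beta> f n)"
      unfolding dirichlet_term_def coeff_f by (intro tendsto_intros a)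
    have "(\<Sum>n<N. dirichlet_term \<beta> (F (r k)) n) \<le> energy \<beta> (F (r k))" for k
      using F(1)[of "r k"] by (intro sum_le_suminf) (auto simp: dirichlet_space_def)
    then show "\<forall>\<^sub>F k in sequentially. (\<Sum>n<N. dirichlet_term \<beta> (F (r k)) n) \<le> M\<^sup>2"
      using F_energy order.trans by (intro always_eventually) blast
  qed simp
  from suminf_le_if_partial_sums_le[OF _ this]
  have f_in: "f \<in> dirichlet_space \<beta>" and f_energy: "energy \<beta> f \<le> M\<^sup>2"
    using hol_f by (auto simp: dirichlet_space_def)
  define h where "h k z = F (r k) z - f z" for k z
  have h_in: "h k \<in> dirichlet_space \<beta>" for k
    unfolding h_def by (rule dirichlet_space_diff(1)[OF F(1) f_in])
  have h_energy: "energy \<beta> (h k) \<le> 4 * M\<^sup>2" for k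
    using dirichlet_space_diff(2)[OF F(1) f_in, of "r k"] F_energy[of "r k"] f_energy
    unfolding h_def by simp
  have coeff_h: "taylor_coeff (h k) n = taylor_coeff (F (r k)) n - a n" for k n
    unfolding h_def by (simp add: taylor_coeff_diff[OF hol hol_f] coeff_f)
  have h_in1: "h k \<in> dirichlet_space 1" for k
    using h_in dirichlet_space_mono[of \<beta> 1] \<beta> by auto
  have lim1: "(\<lambda>k. energy 1 (h k)) \<longlonglongrightarrow> 0"
  proof (rule tendsto_zero_if_le)
    fix \<epsilon> :: real assume \<epsilon>: "0 < \<epsilon>"
    have "(\<lambda>N. (real N + 1) powr (\<beta> - 1) * (4 * M\<^sup>2)) \<longlonglongrightarrow> 0"
      using \<beta> by real_asymp
    then have "\<forall>\<^sub>F N in sequentially. (real N + 1) powr (\<beta> - 1) * (4 * M\<^sup>2) < \<epsilon>"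
      using order_tendstoD(2) \<epsilon> by blast
    then obtain N where N: "(real N + 1) powr (\<beta> - 1) * (4 * M\<^sup>2) < \<epsilon>"
      by (auto simp: eventually_sequentially)
    let ?v = "\<lambda>k. \<Sum>n<N. (cmod (taylor_coeff (F (r k)) n - a n))\<^sup>2"
    have "?v \<longlonglongrightarrow> (\<Sum>n<N. (cmod (a n - a n))\<^sup>2)" by (intro tendsto_intros a)
    then have "?v \<longlonglongrightarrow> 0" by simp
    moreover have "energy 1 (h k) \<le> \<epsilon> + ?v k" for k
    proof -
      have "(real N + 1) powr (\<beta> - 1) * energy \<beta> (h k) \<le> (real N + 1) powr (\<beta> - 1) * (4 * M\<^sup>2)"
        using h_energy by (intro mult_left_mono) auto
      then show ?thesis using hardy_energy_split[OF h_in \<beta>, of k N] N unfolding coeff_h by linarith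
    qed
    ultimately show "\<exists>v. v \<longlonglongrightarrow> 0 \<and> (\<forall>k. energy 1 (h k) \<le> \<epsilon> + v k)" by blast
  qed (rule energy_nonneg[OF h_in1])
  have "(\<lambda>k. energy \<beta> (T (h k))) \<longlonglongrightarrow> 0"
  proof (rule tendsto_zero_if_le)
    fix \<epsilon> :: real assume \<epsilon>: "0 < \<epsilon>"
    \<comment> \<open>The summand \<open>1\<close> keeps the denominator positive when \<open>M = 0\<close>.\<close>
    define \<epsilon>' where "\<epsilon>' = \<epsilon> / (4 * M\<^sup>2 + 1)"
    have pos: "0 < 4 * M\<^sup>2 + 1" by (simp add: add_nonneg_pos)
    have \<epsilon>': "0 < \<epsilon>'" "\<epsilon>' * (4 * M\<^sup>2) \<le> \<epsilon>"
      using \<epsilon> pos by (auto simp: \<epsilon>'_def field_simps)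
    obtain L where L: "\<forall>f\<in>dirichlet_space \<beta>. energy \<beta> (T f) \<le> \<epsilon>' * energy \<beta> f + L * energy 1 f"
      using est[OF \<epsilon>'(1)] by blast
    have "energy \<beta> (T (h k)) \<le> \<epsilon> + L * energy 1 (h k)" for k
      using L[rule_format, OF h_in[of k]] mult_left_mono[OF h_energy[of k] less_imp_le[OF \<epsilon>'(1)]] \<epsilon>'(2)
      by linarith
    moreover have "(\<lambda>k. L * energy 1 (h k)) \<longlonglongrightarrow> 0" using tendsto_mult_left[OF lim1, of L] by simp
    ultimately show "\<exists>v. v \<longlonglongrightarrow> 0 \<and> (\<forall>k. energy \<beta> (T (h k)) \<le> \<epsilon> + v k)" by blast
  qed (rule energy_nonneg[OF T_in[OF h_in]])
  then have "(\<lambda>k. sqrt (energy \<beta> (T (h k)))) \<longlonglongrightarrow> sqrt 0" by (intro tendsto_intros)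
  moreover have "dirichlet_norm \<beta> (\<lambda>z. T (F (r k)) z - T f z) = sqrt (energy \<beta> (T (h k)))" for k
    unfolding dirichlet_norm_def h_def
    by (subst dirichlet_term_cong[OF linear_operator_on_diff[OF lin F(1) f_in, symmetric]]) auto
  ultimately have "(\<lambda>k. dirichlet_norm \<beta> (\<lambda>z. T (F (r k)) z - T f z)) \<longlonglongrightarrow> 0" by simp
  then show "\<exists>g\<in>dirichlet_space \<beta>. \<exists>r. strict_mono r \<and>
      (\<lambda>k. dirichlet_norm \<beta> (\<lambda>z. T (F (r k)) z - g z)) \<longlonglongrightarrow> 0"
    using T_in[OF f_in] r(1) by blast
qed

text \<open>
  For a prescribed \<open>\<epsilon>\<close> in the estimate for \<open>\<beta>\<close>, the \<open>\<delta>\<close> in the estimate for \<open>\<alpha>\<close> is chosen so that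
  its power \<open>\<delta> powr s\<close> cancels the constants.
\<close>

theorem compact_interpolation:
  assumes \<alpha>\<beta>: "\<alpha> < \<beta>" "\<beta> < 1"
    and T1: "bounded_operator_on 1 T" and T\<alpha>: "compact_operator_on \<alpha> T"
  shows "compact_operator_on \<beta> T"
proof -
  let ?s = "(1 - \<beta>) / (1 - \<alpha>)"
  obtain K where lin: "linear_operator_on 1 T" and K: "0 < K"
    "\<And>f. f \<in> dirichlet_space 1 \<Longrightarrow> energy 1 (T f) \<le> K * energy 1 f"
    using T1 unfolding bounded_operator_on_energy by blast
  have T_in1: "T f \<in> dirichlet_space 1" if "f \<in> dirichlet_space 1" for f
    using lin that by (simp add: linear_operator_on_def)
  have T_in: "T f \<in> dirichlet_space \<alpha>" if "f \<in> dirichlet_space \<alpha>" for f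
    using T\<alpha> that by (simp add: compact_operator_on_def linear_operator_on_def)
  have s: "0 < ?s" "?s < 1" using \<alpha>\<beta> by auto
  obtain C where C: "0 < C"
    "\<And>x n. 0 \<le> x \<Longrightarrow> (\<Sum>j<n. (2 powr ?s) ^ j * min 1 (x / 2 ^ j)) \<le> C * x powr ?s"
    using dyadic_sum_upper[OF s] by blast
  have \<alpha>1: "\<alpha> \<le> 1" and K0: "0 \<le> K" using \<alpha>\<beta> K by auto
  have est: "\<exists>L. \<forall>f\<in>dirichlet_space \<beta>. T f \<in> dirichlet_space \<beta> \<and>
      energy \<beta> (T f) \<le> \<epsilon> * energy \<beta> f + L * energy 1 f" if \<epsilon>: "0 < \<epsilon>" for \<epsilon>
  proof -
    define \<delta> where "\<delta> = (\<epsilon> / (4 * C * K)) powr (1 / ?s)"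
    have \<delta>: "0 < \<delta>" using \<epsilon> C K by (simp add: \<delta>_def)
    have "\<delta> powr ?s = (\<epsilon> / (4 * C * K)) powr 1"
    proof -
      have "1 / ?s * ?s = 1" using s by (intro nonzero_eq_divide_eq[THEN iffD1]) auto
      then show ?thesis unfolding \<delta>_def powr_powr by (simp only:)
    qed
    then have \<delta>s: "4 * C * (K * \<delta> powr ?s) = \<epsilon>" using \<epsilon> C K by simp
    obtain L where L: "0 \<le> L"
      "\<And>f. f \<in> dirichlet_space \<alpha> \<Longrightarrow> energy \<alpha> (T f) \<le> K * \<delta> * energy \<alpha> f + L * energy 1 f"
      using compact_imp_hardy_estimate[OF T\<alpha> \<alpha>1 T_in1 K(2) K0, of "K * \<delta>"] K \<delta> by auto
    note * = energy_interpolation[OF \<alpha>\<beta> C(2) lin \<delta> K0 L(1) K(2) T_in L(2)]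
    show ?thesis
    proof (intro exI[of _ "4 * C * L"] ballI conjI)
      fix f assume f: "f \<in> dirichlet_space \<beta>"
      show "T f \<in> dirichlet_space \<beta>" by (rule *(1)[OF _ _ _ _ f])
      have "energy \<beta> (T f) \<le> 4 * C * (K * \<delta> powr ?s * energy \<beta> f + L * energy 1 f)"
        by (rule *(2)[OF _ _ _ _ f])
      also have "\<dots> = 4 * C * (K * \<delta> powr ?s) * energy \<beta> f + 4 * C * L * energy 1 f"
        by (simp add: algebra_simps)
      finally show "energy \<beta> (T f) \<le> \<epsilon> * energy \<beta> f + 4 * C * L * energy 1 f"
        unfolding \<delta>s .
    qed
  qed
  show ?thesis
  proof (rule compact_if_hardy_estimate)
    show "linear_operator_on \<beta> T"
      using est[of 1] \<alpha>\<beta> by (intro linear_operator_on_if_invariant[OF lin]) auto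
  qed (use \<alpha>\<beta> est in blast)+
qed

section \<open>Weighted composition operators on weighted Dirichlet spaces\<close>

theorem proposition3p11:
  fixes \<phi> \<psi> :: "complex \<Rightarrow> complex"
  assumes "self_map \<phi>" and "inj_on \<phi> \<bbbD>"
    and "deriv (deriv \<phi>) \<in> H_inf"
    and "\<psi> holomorphic_on \<bbbD>"
  shows "(bdd_above ((\<lambda>z. cmod (deriv (deriv \<psi>) z) * (1 - (cmod z)\<^sup>2)) ` \<bbbD>) \<longrightarrow>
           (\<forall>\<alpha>\<in>{0<..<1}. bounded_operator_on \<alpha> (weighted_comp \<psi> \<phi>) \<longrightarrow>
              (\<forall>\<beta>\<in>{\<alpha><..<1}. bounded_operator_on \<beta> (weighted_comp \<psi> \<phi>)))) \<and>
         (((\<lambda>z. cmod (deriv (deriv \<psi>) z) * (1 - (cmod z)\<^sup>2)) \<longlongrightarrow> 0)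
             (filtercomap cmod (at_left 1)) \<longrightarrow>
           (\<forall>\<alpha>\<in>{0<..<1}. compact_operator_on \<alpha> (weighted_comp \<psi> \<phi>) \<longrightarrow>
              (\<forall>\<beta>\<in>{\<alpha><..<1}. compact_operator_on \<beta> (weighted_comp \<psi> \<phi>))))"
proof (intro conjI impI ballI)
  fix \<alpha> \<beta> :: real
  assume "bdd_above ((\<lambda>z. cmod (deriv (deriv \<psi>) z) * (1 - (cmod z)\<^sup>2)) ` \<bbbD>)"
  from weighted_comp_bounded_on_hardy[OF assms(1,4) this]
  show "bounded_operator_on \<beta> (weighted_comp \<psi> \<phi>)"
    if "\<beta> \<in> {\<alpha><..<1}" "bounded_operator_on \<alpha> (weighted_comp \<psi> \<phi>)"
    using bounded_interpolation[of \<alpha> \<beta>] that by auto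
next
  fix \<alpha> \<beta> :: real
  assume "((\<lambda>z. cmod (deriv (deriv \<psi>) z) * (1 - (cmod z)\<^sup>2)) \<longlongrightarrow> 0) (filtercomap cmod (at_left 1))"
  from weighted_comp_bounded_on_hardy[OF assms(1,4) bdd_above_if_vanishing_at_boundary[OF assms(4) this]]
  show "compact_operator_on \<beta> (weighted_comp \<psi> \<phi>)"
    if "\<beta> \<in> {\<alpha><..<1}" "compact_operator_on \<alpha> (weighted_comp \<psi> \<phi>)"
    using compact_interpolation[of \<alpha> \<beta>] that by auto
qed

end
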